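(* Let $t>0$, let $r\ge1$ be an integer, let $i_1<\dots<i_M$ be real, let $\underline p\in\mathbb S^M$, let $\underline b=(b_2,\dots,b_{M-1})$ satisfy $-\frac{1}{i_{j+1}-i_j}<b_j<\frac{1}{i_j-i_{j-1}}$ for $j=2,\dots,M-1$, and let $\underline k=(k_2,\dots,k_{M-1})\in\mathbb R_+^{M-2}$. Set $$\mathcal A(\underline\lambda,\underline p)(j):=\mathcal G_j\Big(\frac tr,\;Q\Big(\frac tr,\underline h^{(r-1)}(\underline p,\underline\lambda),\underline\lambda\Big)\Big),\qquad j=2,\dots,M-1 .$$ Then there exists a solution $\underline\lambda\in\mathbb R_+^{M-2}$ to the equation $\underline\lambda=\mathcal A(\underline\lambda,\underline p)$ (that is, $\underline\lambda$ such that $Q(\frac tr,\underline h^{(r-1)}(\underline p,\underline\lambda),\underline\lambda)$ is defined and lies in $\mathbb S^M$, so that the right hand side makes sense, and $\lambda_j=\mathcal A(\underline\lambda,\underline p)(j)$ for $j=2,\dots,M-1$).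
   Context: Conventions: $\mathbb R_+=[0,\infty)$, $M\ge3$, $\mathbb S^M=\{(p_1,\dots,p_M):0<p_j<1,\ \sum_jp_j=1\}$; probability vectors are row vectors; $\lambda_1=\lambda_M=0$ for $\underline\lambda=(\lambda_2,\dots,\lambda_{M-1})$. Set $\widetilde k_j=(i_{j+1}-i_j)(i_j-i_{j-1})k_j$ for $2\le j\le M-1$, $\widetilde k_1=\widetilde k_M=0$; for $2\le j\le M-1$, $q_{j,j+1}=\frac{i_j-i_{j-1}}{i_{j+1}-i_{j-1}}(1+(i_{j+1}-i_j)b_j)$, $q_{j,j-1}=\frac{i_{j+1}-i_j}{i_{j+1}-i_{j-1}}(1-(i_j-i_{j-1})b_j)$. For $s>0$, $\mathcal N_s=\mathcal N_s(\underline\lambda)$ is the $M\times M$ matrix whose first and last rows are those of the identity matrix and, for $2\le j\le M-1$, $\mathcal N_{s;j,j}=1+s\lambda_j(1+\widetilde k_j)$, $\mathcal N_{s;j,j+1}=-s\lambda_jq_{j,j+1}$, $\mathcal N_{s;j,j-1}=-s\lambda_jq_{j,j-1}$, other entries $0$. Put $$\underline h(\underline p,\underline\lambda)=\frac{1}{\sum_jp_j(1+\frac tr\lambda_j\widetilde k_j)}\,\underline p\,\mathcal N_{t/r}(\underline\lambda),\qquad \underline h^{(0)}(\underline p,\underline\lambda)=\underline p,\quad \underline h^{(1)}=\underline h,\quad \underline h^{(n)}(\underline p,\underline\lambda)=\underline h(\underline h^{(n-1)}(\underline p,\underline\lambda),\underline\lambda)\ (n\ge2),$$ $$Q_j(s,\underline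 p,\underline\lambda)=\frac{p_j(1+s\widetilde k_j\lambda_j)}{\sum_{i=1}^Mp_i(1+s\widetilde k_i\lambda_i)},\qquad j=1,\dots,M.$$ Coordinate change $\underline\kappa=(\kappa_1,\dots,\kappa_M)$ (built once from the target $\underline p$): let $\delta_j=i_j-i_{j-1}$ ($2\le j\le M$); $\Pi_1=1$, $\Pi_j=\prod_{n=2}^j\frac{1-\delta_nb_n}{1+\delta_{n+1}b_n}$ ($2\le j\le M-1$). Fix $\vartheta\in(0,\frac12)$ with $e_-:=\inf\{j:\sum_{i=1}^jp_i\ge\vartheta\}<e_+:=\sup\{j:\sum_{i=j}^Mp_i\ge\vartheta\}$, let $K=(i_{e_+}-i_{e_-})\vee1$, $\epsilon_{j+1}=K\,\delta_{j+1}\Pi_j\big/\sum_{a=e_-}^{e_+-1}\delta_{a+1}\Pi_a$ ($1\le j\le M-1$). Let $e$ satisfy $\sum_{i\le e}p_i\ge\frac12$, $\sum_{i\ge e}p_i\ge\frac12$. Then $\kappa_e=0$ and $\kappa_j-\kappa_{j-1}=\epsilon_j$ for $2\le j\le M$; $\underline\kappa$ is strictly increasing and $q_{j,j+1}=\frac{\kappa_j-\kappa_{j-1}}{\kappa_{j+1}-\kappa_{j-1}}$, $q_{j,j-1}=\frac{\kappa_{j+1}-\kappa_j}{\kappa_{j+1}-\kappa_{j-1}}$. For $s>0$ and $\underline\pi\in\mathbb S^M$, $\mathcal G(s,\underline\pi)=(\mathcal G_1,\dots,\mathcal G_M)$ (nonnegative entries) is defined by the system: $\mathcal G_1=\mathcal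 G_M=0$, $$\mathcal G_j=\frac{1}{s\pi_j}\frac{\kappa_{j+1}-\kappa_{j-1}}{(\kappa_{j+1}-\kappa_j)(\kappa_j-\kappa_{j-1})}\times\begin{cases}\sum_{a=1}^{j-1}(\kappa_j-\kappa_a)\pi_a(1+s\mathcal G_a\widetilde k_a)&2\le j\le l-1\\ \sum_{a=j+1}^{M}(\kappa_a-\kappa_j)\pi_a(1+s\mathcal G_a\widetilde k_a)&l\le j\le M-1\end{cases}$$ where $l$ is the index with $\kappa_{l-1}<\frac{\sum_{j=1}^M\kappa_j\pi_j(1+s\mathcal G_j\widetilde k_j)}{\sum_{j=1}^M\pi_j(1+s\mathcal G_j\widetilde k_j)}\le\kappa_l$. *)

theory Defs
  imports Complex_Main
begin

text \<open>
  Vectors indexed by \<open>1..M\<close> (or \<open>2..M-1\<close>) are functions of type \<^typ>\<open>nat \<Rightarrow> real\<close> of which only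
  the values at these indices matter. The symbol \<open>lam\<close> stands for the vector of intensities,
  extended by \<open>lam 1 = lam M = 0\<close>.
\<close>

definition prob_simplex :: "nat \<Rightarrow> (nat \<Rightarrow> real) set" where
  "prob_simplex M = {p. (\<forall>j\<in>{1..M}. 0 < p j \<and> p j < 1) \<and> (\<Sum>j=1..M. p j) = 1}"

definition ktilde :: "nat \<Rightarrow> (nat \<Rightarrow> real) \<Rightarrow> (nat \<Rightarrow> real) \<Rightarrow> nat \<Rightarrow> real" where
  "ktilde M i k j =
     (if 2 \<le> j \<and> j \<le> M - 1 then (i (j + 1) - i j) * (i j - i (j - 1)) * k j else 0)"

definition q_up :: "(nat \<Rightarrow> real) \<Rightarrow> (nat \<Rightarrow> real) \<Rightarrow> nat \<Rightarrow> real" where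
  "q_up i b j = (i j - i (j - 1)) / (i (j + 1) - i (j - 1)) * (1 + (i (j + 1) - i j) * b j)"

definition q_down :: "(nat \<Rightarrow> real) \<Rightarrow> (nat \<Rightarrow> real) \<Rightarrow> nat \<Rightarrow> real" where
  "q_down i b j = (i (j + 1) - i j) / (i (j + 1) - i (j - 1)) * (1 - (i j - i (j - 1)) * b j)"

text \<open>\<open>N_mat M i b k s lam a c\<close> is the entry in row \<open>a\<close> and column \<open>c\<close>.\<close>

definition N_mat ::
  "nat \<Rightarrow> (nat \<Rightarrow> real) \<Rightarrow> (nat \<Rightarrow> real) \<Rightarrow> (nat \<Rightarrow> real) \<Rightarrow> real \<Rightarrow> (nat \<Rightarrow> real) \<Rightarrow> nat \<Rightarrow> nat \<Rightarrow> real"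
where
  "N_mat M i b k s lam a c =
     (if 2 \<le> a \<and> a \<le> M - 1 then
        (if c = a then 1 + s * lam a * (1 + ktilde M i k a)
         else if c = a + 1 then - s * lam a * q_up i b a
         else if c = a - 1 then - s * lam a * q_down i b a
         else 0)
      else (if c = a then 1 else 0))"

definition norm_const ::
  "nat \<Rightarrow> (nat \<Rightarrow> real) \<Rightarrow> (nat \<Rightarrow> real) \<Rightarrow> real \<Rightarrow> (nat \<Rightarrow> real) \<Rightarrow> (nat \<Rightarrow> real) \<Rightarrow> real"
where
  "norm_const M i k s p lam = (\<Sum>j=1..M. p j * (1 + s * lam j * ktilde M i k j))"

definition h_map ::
  "nat \<Rightarrow> (nat \<Rightarrow> real) \<Rightarrow> (nat \<Rightarrow> real) \<Rightarrow> (nat \<Rightarrow> real) \<Rightarrow> real \<Rightarrow> (nat \<Rightarrow> real) \<Rightarrow> (nat \<Rightarrow> real) \<Rightarrow> nat \<Rightarrow> real"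
where
  "h_map M i b k s p lam c =
     1 / norm_const M i k s p lam * (\<Sum>a=1..M. p a * N_mat M i b k s lam a c)"

definition h_iter ::
  "nat \<Rightarrow> (nat \<Rightarrow> real) \<Rightarrow> (nat \<Rightarrow> real) \<Rightarrow> (nat \<Rightarrow> real) \<Rightarrow> real \<Rightarrow> nat \<Rightarrow> (nat \<Rightarrow> real) \<Rightarrow> (nat \<Rightarrow> real) \<Rightarrow> nat \<Rightarrow> real"
where
  "h_iter M i b k s n p lam = ((\<lambda>x. h_map M i b k s x lam) ^^ n) p"

definition Q_vec ::
  "nat \<Rightarrow> (nat \<Rightarrow> real) \<Rightarrow> (nat \<Rightarrow> real) \<Rightarrow> real \<Rightarrow> (nat \<Rightarrow> real) \<Rightarrow> (nat \<Rightarrow> real) \<Rightarrow> nat \<Rightarrow> real"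
where
  "Q_vec M i k s p lam j = p j * (1 + s * ktilde M i k j * lam j) / norm_const M i k s p lam"

text \<open>
  Division by zero yields zero in HOL, so that the denominators occurring in \<open>h\<^sup>(\<^sup>1\<^sup>), \<dots>, h\<^sup>(\<^sup>r\<^sup>-\<^sup>1\<^sup>)\<close> and in
  \<open>Q(s, h\<^sup>(\<^sup>r\<^sup>-\<^sup>1\<^sup>), lam)\<close> have to be required explicitly to be nonzero.
\<close>

definition Q_defined ::
  "nat \<Rightarrow> (nat \<Rightarrow> real) \<Rightarrow> (nat \<Rightarrow> real) \<Rightarrow> (nat \<Rightarrow> real) \<Rightarrow> real \<Rightarrow> nat \<Rightarrow> (nat \<Rightarrow> real) \<Rightarrow> (nat \<Rightarrow> real) \<Rightarrow> bool"
where
  "Q_defined M i b k s r p lam \<longleftrightarrow> (\<forall>n<r. norm_const M i k s (h_iter M i b k s n p lam) lam \<noteq> 0)"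

definition delta :: "(nat \<Rightarrow> real) \<Rightarrow> nat \<Rightarrow> real" where
  "delta i j = i j - i (j - 1)"

definition Pi_prod :: "(nat \<Rightarrow> real) \<Rightarrow> (nat \<Rightarrow> real) \<Rightarrow> nat \<Rightarrow> real" where
  "Pi_prod i b j = (\<Prod>n=2..j. (1 - delta i n * b n) / (1 + delta i (n + 1) * b n))"

definition e_minus :: "nat \<Rightarrow> (nat \<Rightarrow> real) \<Rightarrow> real \<Rightarrow> nat" where
  "e_minus M p \<theta> = Inf {j\<in>{1..M}. (\<Sum>a=1..j. p a) \<ge> \<theta>}"

definition e_plus :: "nat \<Rightarrow> (nat \<Rightarrow> real) \<Rightarrow> real \<Rightarrow> nat" where
  "e_plus M p \<theta> = Sup {j\<in>{1..M}. (\<Sum>a=j..M. p a) \<ge> \<theta>}"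

definition K_const :: "nat \<Rightarrow> (nat \<Rightarrow> real) \<Rightarrow> (nat \<Rightarrow> real) \<Rightarrow> real \<Rightarrow> real" where
  "K_const M i p \<theta> = max (i (e_plus M p \<theta>) - i (e_minus M p \<theta>)) 1"

definition epsilon ::
  "nat \<Rightarrow> (nat \<Rightarrow> real) \<Rightarrow> (nat \<Rightarrow> real) \<Rightarrow> (nat \<Rightarrow> real) \<Rightarrow> real \<Rightarrow> nat \<Rightarrow> real"
where
  "epsilon M i b p \<theta> j =
     K_const M i p \<theta> * delta i j * Pi_prod i b (j - 1) /
       (\<Sum>a=e_minus M p \<theta>..e_plus M p \<theta> - 1. delta i (a + 1) * Pi_prod i b a)"

definition kappa ::
  "nat \<Rightarrow> (nat \<Rightarrow> real) \<Rightarrow> (nat \<Rightarrow> real) \<Rightarrow> (nat \<Rightarrow> real) \<Rightarrow> real \<Rightarrow> nat \<Rightarrow> nat \<Rightarrow> real"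
where
  "kappa M i b p \<theta> e j =
     (\<Sum>n=2..j. epsilon M i b p \<theta> n) - (\<Sum>n=2..e. epsilon M i b p \<theta> n)"

lemma kappa_e: "kappa M i b p \<theta> e e = 0"
  by (simp add: kappa_def)

lemma kappa_increment:
  assumes "2 \<le> j"
  shows "kappa M i b p \<theta> e j - kappa M i b p \<theta> e (j - 1) = epsilon M i b p \<theta> j"
proof -
  from assms obtain m where "j = Suc m" "1 \<le> m"
    by (cases j) auto
  then show ?thesis
    by (simp add: kappa_def)
qed

definition kappa_mean ::
  "nat \<Rightarrow> (nat \<Rightarrow> real) \<Rightarrow> (nat \<Rightarrow> real) \<Rightarrow> real \<Rightarrow> (nat \<Rightarrow> real) \<Rightarrow> (nat \<Rightarrow> real) \<Rightarrow> real"
where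
  "kappa_mean M \<kappa> kt s \<pi> g =
     (\<Sum>j=1..M. \<kappa> j * \<pi> j * (1 + s * g j * kt j)) / (\<Sum>j=1..M. \<pi> j * (1 + s * g j * kt j))"

definition G_system ::
  "nat \<Rightarrow> (nat \<Rightarrow> real) \<Rightarrow> (nat \<Rightarrow> real) \<Rightarrow> real \<Rightarrow> (nat \<Rightarrow> real) \<Rightarrow> (nat \<Rightarrow> real) \<Rightarrow> bool"
where
  "G_system M \<kappa> kt s \<pi> g \<longleftrightarrow>
     (\<forall>j\<in>{1..M}. 0 \<le> g j) \<and> g 1 = 0 \<and> g M = 0 \<and>
     (\<exists>l\<in>{2..M}.
        \<kappa> (l - 1) < kappa_mean M \<kappa> kt s \<pi> g \<and> kappa_mean M \<kappa> kt s \<pi> g \<le> \<kappa> l \<and>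
        (\<forall>j\<in>{2..M - 1}.
           g j = 1 / (s * \<pi> j) *
                 ((\<kappa> (j + 1) - \<kappa> (j - 1)) / ((\<kappa> (j + 1) - \<kappa> j) * (\<kappa> j - \<kappa> (j - 1)))) *
                 (if j \<le> l - 1
                  then (\<Sum>a=1..j - 1. (\<kappa> j - \<kappa> a) * \<pi> a * (1 + s * g a * kt a))
                  else (\<Sum>a=j + 1..M. (\<kappa> a - \<kappa> j) * \<pi> a * (1 + s * g a * kt a)))))"

lemma G_system_unique:
  fixes \<kappa> kt \<pi> :: "nat \<Rightarrow> real"
  assumes M: "3 \<le> M" and \<kappa>: "strict_mono_on {1..M} \<kappa>" and kt: "\<forall>j\<in>{1..M}. 0 \<le> kt j"
    and s: "0 < s" and \<pi>: "\<pi> \<in> prob_simplex M"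
  shows "\<exists>!g. G_system M \<kappa> kt s \<pi> g \<and> (\<forall>j. j \<notin> {1..M} \<longrightarrow> g j = 0)"
proof -
  define c where "c j = 1 / (s * \<pi> j) *
      ((\<kappa> (j + 1) - \<kappa> (j - 1)) / ((\<kappa> (j + 1) - \<kappa> j) * (\<kappa> j - \<kappa> (j - 1))))" for j
  define w where "w g j = \<pi> j * (1 + s * g j * kt j)" for g j
  define FL where "FL g j = (\<Sum>a=1..j - 1. (\<kappa> j - \<kappa> a) * w g a)" for g j
  define FR where "FR g j = (\<Sum>a=j + 1..M. (\<kappa> a - \<kappa> j) * w g a)" for g j
  define gL where "gL = wfrec less_than (\<lambda>g j. if 2 \<le> j \<and> j \<le> M - 1 then c j * FL g j else 0)"
  define gR where
    "gR = wfrec (measure (\<lambda>j. M - j)) (\<lambda>g j. if 2 \<le> j \<and> j \<le> M - 1 then c j * FR g j else 0)"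
  have less: "\<kappa> a < \<kappa> b" if "1 \<le> a" "a < b" "b \<le> M" for a b
    using \<kappa> that by (auto simp: strict_mono_on_def)
  have pos: "0 < \<pi> j" if "j \<in> {1..M}" for j
    using \<pi> that by (auto simp: prob_simplex_def)
  have cpos: "0 < c j" if "2 \<le> j" "j \<le> M - 1" for j
    unfolding c_def using that M s pos[of j] less[of j "j + 1"] less[of "j - 1" j] less[of "j - 1" "j + 1"]
    by (intro mult_pos_pos divide_pos_pos) auto
  have FL_cong: "FL g j = FL g' j" if "\<And>a. 1 \<le> a \<Longrightarrow> a < j \<Longrightarrow> g a = g' a" for g g' j
    unfolding FL_def w_def using that by (intro sum.cong) auto
  have FR_cong: "FR g j = FR g' j" if "\<And>a. j < a \<Longrightarrow> a \<le> M \<Longrightarrow> g a = g' a" for g g' j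
    unfolding FR_def w_def using that by (intro sum.cong) auto
  have gL: "gL j = (if 2 \<le> j \<and> j \<le> M - 1 then c j * FL gL j else 0)" for j
    by (subst gL_def, subst wfrec, simp, fold gL_def)
       (auto intro!: FL_cong simp: cut_def)
  have gR: "gR j = (if 2 \<le> j \<and> j \<le> M - 1 then c j * FR gR j else 0)" for j
    by (subst gR_def, subst wfrec, simp, fold gR_def)
       (auto intro!: FR_cong simp: cut_def)
  have wpos: "0 < w g j" if "j \<in> {1..M}" "0 \<le> g j" for g j
    unfolding w_def using that pos[of j] kt s
    by (intro mult_pos_pos) (auto intro!: add_pos_nonneg)
  have gL0: "0 \<le> gL j" for j
  proof (induction j rule: less_induct)
    case (less j)
    show ?case
    proof (cases "2 \<le> j \<and> j \<le> M - 1")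
      case True
      have "0 \<le> FL gL j"
        unfolding FL_def
      proof (rule sum_nonneg)
        fix a assume a: "a \<in> {1..j - 1}"
        then have "\<kappa> a < \<kappa> j" using True M \<open>\<And>a b. 1 \<le> a \<Longrightarrow> a < b \<Longrightarrow> b \<le> M \<Longrightarrow> \<kappa> a < \<kappa> b\<close>[of a j] by auto
        moreover have "0 < w gL a" using a True less by (intro wpos) auto
        ultimately show "0 \<le> (\<kappa> j - \<kappa> a) * w gL a" by simp
      qed
      then show ?thesis using True cpos[of j] by (subst gL) simp
    qed (subst gL, auto)
  qed
  have gR0: "0 \<le> gR j" for j
  proof (induction j rule: measure_induct_rule[where f = "\<lambda>j. M - j"])
    case (less j)
    show ?case
    proof (cases "2 \<le> j \<and> j \<le> M - 1")
      case True
      have "0 \<le> FR gR j"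
        unfolding FR_def
      proof (rule sum_nonneg)
        fix a assume a: "a \<in> {j + 1..M}"
        then have "\<kappa> j < \<kappa> a" using True M \<open>\<And>a b. 1 \<le> a \<Longrightarrow> a < b \<Longrightarrow> b \<le> M \<Longrightarrow> \<kappa> a < \<kappa> b\<close>[of j a] by auto
        moreover have "0 < w gR a" using a True less by (intro wpos) auto
        ultimately show "0 \<le> (\<kappa> a - \<kappa> j) * w gR a" by simp
      qed
      then show ?thesis using True cpos[of j] by (subst gR) simp
    qed (subst gR, auto)
  qed
  have wL: "0 < w gL j" and wR: "0 < w gR j" if "j \<in> {1..M}" for j
    using that wpos gL0 gR0 by auto
  define D where "D j = FL gL j - FR gR j" for j
  have step: "D j < D (Suc j)" if "1 \<le> j" "j < M" for j
  proof -
    have "FL gL j = (\<Sum>a=1..j. (\<kappa> j - \<kappa> a) * w gL a)"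
      unfolding FL_def using that by (cases j) auto
    also have "\<dots> < (\<Sum>a=1..j. (\<kappa> (Suc j) - \<kappa> a) * w gL a)"
      using that less[of j "Suc j"] wL by (intro sum_strict_mono) auto
    finally have 1: "FL gL j < FL gL (Suc j)" by (simp add: FL_def)
    have "FR gR (Suc j) = (\<Sum>a=j + 1..M. (\<kappa> a - \<kappa> (Suc j)) * w gR a)"
      unfolding FR_def using that by (simp add: sum.atLeast_Suc_atMost[of "Suc j" M])
    also have "\<dots> < FR gR j"
      unfolding FR_def using that less[of j "Suc j"] wR by (intro sum_strict_mono) auto
    finally show ?thesis using 1 by (simp add: D_def)
  qed
  have mono: "D a \<le> D b" if "1 \<le> a" "a \<le> b" "b \<le> M" for a b
    using that(2,1,3)
  proof (induction b rule: dec_induct)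
    case (step n)
    then show ?case using \<open>\<And>j. 1 \<le> j \<Longrightarrow> j < M \<Longrightarrow> D j < D (Suc j)\<close>[of n] by auto
  qed simp
  have D1: "D 1 < 0"
  proof -
    have "0 < FR gR 1"
      unfolding FR_def using M less wR by (intro sum_pos) auto
    then show ?thesis by (simp add: D_def FL_def)
  qed
  have DM: "0 < D M"
  proof -
    have "0 < FL gL M"
      unfolding FL_def using M less wL by (intro sum_pos) auto
    then show ?thesis by (simp add: D_def FR_def)
  qed
  define mix where "mix l j = (if j < l then gL j else gR j)" for l j
  have mean_iff: "(\<kappa> (l - 1) < kappa_mean M \<kappa> kt s \<pi> (mix l) \<and> kappa_mean M \<kappa> kt s \<pi> (mix l) \<le> \<kappa> l)
      \<longleftrightarrow> D (l - 1) < 0 \<and> 0 \<le> D l" if l: "l \<in> {2..M}" for l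
  proof -
    define W where "W = (\<Sum>j=1..M. w (mix l) j)"
    have W: "0 < W"
      unfolding W_def using M gL0 gR0 by (intro sum_pos wpos) (auto simp: mix_def)
    have mean: "kappa_mean M \<kappa> kt s \<pi> (mix l) = (\<Sum>j=1..M. \<kappa> j * w (mix l) j) / W"
      by (simp add: kappa_mean_def W_def w_def mult.assoc)
    have eq: "(\<Sum>j=1..M. \<kappa> j * w (mix l) j) - x * W =
        (\<Sum>a=1..l - 1. (\<kappa> a - x) * w gL a) + (\<Sum>a=l..M. (\<kappa> a - x) * w gR a)" for x
    proof -
      have "(\<Sum>j=1..M. \<kappa> j * w (mix l) j) - x * W = (\<Sum>j=1..M. (\<kappa> j - x) * w (mix l) j)"
        by (simp add: W_def sum_distrib_left sum_subtractf left_diff_distrib)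
      also have "\<dots> = (\<Sum>j\<in>{1..l - 1} \<union> {l..M}. (\<kappa> j - x) * w (mix l) j)"
        using l by (intro sum.cong) auto
      also have "(\<Sum>j\<in>{1..l - 1} \<union> {l..M}. (\<kappa> j - x) * w (mix l) j) =
          (\<Sum>j=1..l - 1. (\<kappa> j - x) * w (mix l) j) + (\<Sum>j=l..M. (\<kappa> j - x) * w (mix l) j)"
        by (intro sum.union_disjoint) auto
      also have "(\<Sum>j=1..l - 1. (\<kappa> j - x) * w (mix l) j) = (\<Sum>a=1..l - 1. (\<kappa> a - x) * w gL a)"
        by (intro sum.cong) (auto simp: w_def mix_def)
      also have "(\<Sum>j=l..M. (\<kappa> j - x) * w (mix l) j) = (\<Sum>a=l..M. (\<kappa> a - x) * w gR a)"
        by (intro sum.cong) (auto simp: w_def mix_def)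
      finally show ?thesis .
    qed
    have neg: "(\<Sum>a\<in>A. (\<kappa> a - x) * w gL a) = - (\<Sum>a\<in>A. (x - \<kappa> a) * w gL a)" for A x
      by (simp add: sum_negf[symmetric] left_diff_distrib)
    have 1: "(\<Sum>j=1..M. \<kappa> j * w (mix l) j) - \<kappa> (l - 1) * W = - D (l - 1)"
    proof -
      have "(\<Sum>a=1..l - 1. (\<kappa> (l - 1) - \<kappa> a) * w gL a) = FL gL (l - 1)"
        unfolding FL_def using l by (cases "l - 1") auto
      moreover have "(\<Sum>a=l..M. (\<kappa> a - \<kappa> (l - 1)) * w gR a) = FR gR (l - 1)"
        unfolding FR_def using l by simp
      ultimately show ?thesis unfolding eq neg D_def by simp
    qed
    have 2: "(\<Sum>j=1..M. \<kappa> j * w (mix l) j) - \<kappa> l * W = - D l"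
    proof -
      have "(\<Sum>a=1..l - 1. (\<kappa> l - \<kappa> a) * w gL a) = FL gL l"
        by (simp add: FL_def)
      moreover have "(\<Sum>a=l..M. (\<kappa> a - \<kappa> l) * w gR a) = FR gR l"
        unfolding FR_def using l by (simp add: sum.atLeast_Suc_atMost[of l M])
      ultimately show ?thesis unfolding eq neg D_def by simp
    qed
    show ?thesis
      unfolding mean using W 1 2 by (auto simp: pos_less_divide_eq pos_divide_le_eq)
  qed
  have system_iff: "G_system M \<kappa> kt s \<pi> g \<longleftrightarrow>
      (\<forall>j\<in>{1..M}. 0 \<le> g j) \<and> g 1 = 0 \<and> g M = 0 \<and>
      (\<exists>l\<in>{2..M}. (\<kappa> (l - 1) < kappa_mean M \<kappa> kt s \<pi> g \<and> kappa_mean M \<kappa> kt s \<pi> g \<le> \<kappa> l) \<and>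
        (\<forall>j\<in>{2..M - 1}. g j = c j * (if j \<le> l - 1 then FL g j else FR g j)))" for g
    unfolding G_system_def c_def FL_def FR_def w_def by (simp add: mult.assoc conj_assoc)
  have out: "gL j = 0" "gR j = 0" if "j \<notin> {2..M - 1}" for j
    using that by (subst gL gR, auto)+
  have mix: "g = mix l" if l: "l \<in> {2..M}"
    and eqs: "\<forall>j\<in>{2..M - 1}. g j = c j * (if j \<le> l - 1 then FL g j else FR g j)"
    and z: "g 1 = 0" "g M = 0" "\<forall>j. j \<notin> {1..M} \<longrightarrow> g j = 0" for g l
  proof -
    have g0: "g j = 0" if "j \<notin> {2..M - 1}" for j
    proof -
      from that have "j = 1 \<or> j = M \<or> j \<notin> {1..M}" by auto
      with z show ?thesis by auto
    qed
    have "j < l \<longrightarrow> g j = gL j" for j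
    proof (induction j rule: less_induct)
      case (less j)
      show ?case
      proof (cases "j \<in> {2..M - 1}")
        case True
        show ?thesis
        proof
          assume "j < l"
          then have "g j = c j * FL g j" using eqs True by auto
          also have "FL g j = FL gL j" using less \<open>j < l\<close> by (intro FL_cong) auto
          finally show "g j = gL j" using True by (subst gL) auto
        qed
      qed (use g0 out in auto)
    qed
    moreover have "l \<le> j \<longrightarrow> g j = gR j" for j
    proof (induction j rule: measure_induct_rule[where f = "\<lambda>j. M - j"])
      case (less j)
      show ?case
      proof (cases "j \<in> {2..M - 1}")
        case True
        show ?thesis
        proof
          assume "l \<le> j"
          then have "\<not> j \<le> l - 1" using l by auto
          then have "g j = c j * FR g j" using eqs True by auto
          also have "FR g j = FR gR j" using less \<open>l \<le> j\<close> by (intro FR_cong) auto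
          finally show "g j = gR j" using True by (subst gR) auto
        qed
      qed (use g0 out in auto)
    qed
    ultimately show ?thesis by (auto simp: mix_def fun_eq_iff)
  qed
  define l where "l = (LEAST j. 1 \<le> j \<and> 0 \<le> D j)"
  have PM: "1 \<le> M \<and> 0 \<le> D M" using M DM by auto
  have l: "1 \<le> l \<and> 0 \<le> D l" unfolding l_def by (rule LeastI[where P = "\<lambda>j. 1 \<le> j \<and> 0 \<le> D j" and k = M, OF PM])
  have lM: "l \<le> M" unfolding l_def by (rule Least_le[where P = "\<lambda>j. 1 \<le> j \<and> 0 \<le> D j" and k = M, OF PM])
  have "l \<noteq> 1" using D1 l by auto
  then have l2: "l \<in> {2..M}" using l lM by auto
  have lm: "D (l - 1) < 0"
    using not_less_Least[of "l - 1" "\<lambda>j. 1 \<le> j \<and> 0 \<le> D j"] l2 unfolding l_def[symmetric] by auto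
  show ?thesis
  proof (rule ex1I[of _ "mix l"])
    have "mix l j = c j * (if j \<le> l - 1 then FL (mix l) j else FR (mix l) j)" if j: "j \<in> {2..M - 1}" for j
    proof (cases "j < l")
      case True
      then have "FL (mix l) j = FL gL j" by (intro FL_cong) (auto simp: mix_def)
      then show ?thesis using True j by (auto simp: mix_def gL[of j])
    next
      case False
      then have "FR (mix l) j = FR gR j" by (intro FR_cong) (auto simp: mix_def)
      then show ?thesis using False j l2 by (auto simp: mix_def gR[of j])
    qed
    then have "G_system M \<kappa> kt s \<pi> (mix l)"
      unfolding system_iff using l l2 lm mean_iff[OF l2] gL0 gR0 out M
      by (auto simp: mix_def intro!: bexI[of _ l])
    moreover have "mix l j = 0" if "j \<notin> {1..M}" for j
    proof -
      from that have "j \<notin> {2..M - 1}" by auto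
      from out[OF this] show ?thesis by (simp add: mix_def)
    qed
    ultimately show "G_system M \<kappa> kt s \<pi> (mix l) \<and> (\<forall>j. j \<notin> {1..M} \<longrightarrow> mix l j = 0)"
      by blast
  next
    fix g assume g: "G_system M \<kappa> kt s \<pi> g \<and> (\<forall>j. j \<notin> {1..M} \<longrightarrow> g j = 0)"
    then obtain m where m: "m \<in> {2..M}"
      "\<kappa> (m - 1) < kappa_mean M \<kappa> kt s \<pi> g \<and> kappa_mean M \<kappa> kt s \<pi> g \<le> \<kappa> m"
      "\<forall>j\<in>{2..M - 1}. g j = c j * (if j \<le> m - 1 then FL g j else FR g j)"
      unfolding system_iff by blast
    have gm: "g = mix m" using m g by (intro mix) (auto simp: system_iff)
    then have Dm: "D (m - 1) < 0 \<and> 0 \<le> D m" using m mean_iff[OF m(1)] by simp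
    have "\<not> m < l"
    proof
      assume "m < l"
      then have "D m \<le> D (l - 1)" using l2 m(1) by (intro mono) auto
      with lm Dm show False by simp
    qed
    moreover have "\<not> l < m"
    proof
      assume "l < m"
      then have "D l \<le> D (m - 1)" using l2 m(1) by (intro mono) auto
      with l Dm show False by simp
    qed
    ultimately show "g = mix l" using gm by (metis linorder_neqE_nat)
  qed
qed

text \<open>
  The values outside \<open>1..M\<close> are set to zero; by \<open>G_system_unique\<close> there is then exactly one such function.
\<close>

definition G_vec ::
  "nat \<Rightarrow> (nat \<Rightarrow> real) \<Rightarrow> (nat \<Rightarrow> real) \<Rightarrow> real \<Rightarrow> (nat \<Rightarrow> real) \<Rightarrow> nat \<Rightarrow> real"
where
  "G_vec M \<kappa> kt s \<pi> = (THE g. G_system M \<kappa> kt s \<pi> g \<and> (\<forall>j. j \<notin> {1..M} \<longrightarrow> g j = 0))"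

definition A_map ::
  "nat \<Rightarrow> (nat \<Rightarrow> real) \<Rightarrow> (nat \<Rightarrow> real) \<Rightarrow> (nat \<Rightarrow> real) \<Rightarrow> real \<Rightarrow> nat \<Rightarrow> real \<Rightarrow> nat \<Rightarrow>
   (nat \<Rightarrow> real) \<Rightarrow> (nat \<Rightarrow> real) \<Rightarrow> nat \<Rightarrow> real"
where
  "A_map M i b k \<theta> e t r lam p j =
     G_vec M (kappa M i b p \<theta> e) (ktilde M i k) (t / real r)
       (Q_vec M i k (t / real r) (h_iter M i b k (t / real r) (r - 1) p lam) lam) j"

end

theory Submission
  imports Defs "HOL-Analysis.Analysis"
begin

text \<open>
  Write \<open>s = t / r\<close>. For \<open>\<pi>\<close> in the open simplex put \<open>\<lambda> = G(s, \<pi>)\<close>, \<open>v\<^sub>0 = \<pi> D\<^sup>-\<^sup>1\<close> with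
  \<open>D = diag(1 + s k\<^sub>j \<lambda>\<^sub>j)\<close>, where \<open>k\<^sub>j\<close> is \<open>ktilde\<close>, and \<open>v\<^sub>n = v\<^sub>0 N\<^sup>-\<^sup>n\<close>; all \<open>v\<^sub>n\<close> are positive. Then \<open>\<lambda>\<close> is a solution
  as soon as \<open>v\<close> with index \<open>r - 1\<close>, divided by its total mass, equals \<open>p\<close>. So it suffices that the
  continuous map \<open>\<Phi>\<close> sending \<open>\<pi>\<close> to this normalised vector is onto the open simplex.

  This follows from Brouwer's theorem once \<open>\<Phi>(\<pi>)\<^sub>j\<close> tends to \<open>0\<close> with \<open>\<pi>\<^sub>j\<close>, uniformly in \<open>\<pi>\<close>:
  the map \<open>\<pi>\<^sub>j \<mapsto> (\<pi>\<^sub>j + g\<^sub>j) / (1 + \<Sum> g)\<close>, \<open>g\<^sub>j = max 0 (p\<^sub>j - \<Phi>(\<pi>)\<^sub>j)\<close>, then preserves a truncated simplex,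
  and at a fixed point all \<open>g\<^sub>j\<close> vanish. For the uniform smallness, either \<open>\<lambda>\<^sub>j\<close> is large and mass leaves
  \<open>j\<close> at once, or one of the two moments defining \<open>G\<^sub>j\<close> is small. In the latter case \<open>\<pi>\<close> has little mass on
  that side of \<open>j\<close>, and the nearest site beyond \<open>j\<close> carrying some mass has a small intensity, so it
  hardly lets any mass through to \<open>j\<close>.
\<close>

section \<open>Brouwer's fixed point theorem for boxes in a function space\<close>

lemma tendsto_fun_iff:
  fixes X :: "'c \<Rightarrow> 'a \<Rightarrow> 'b::topological_space"
  shows "(X \<longlongrightarrow> x) F \<longleftrightarrow> (\<forall>j. ((\<lambda>n. X n j) \<longlongrightarrow> x j) F)"
proof -
  have "(X \<longlongrightarrow> x) F \<longleftrightarrow> limitin (product_topology (\<lambda>_. euclidean) UNIV) X x F"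
    by (simp add: euclidean_product_topology)
  also have "\<dots> \<longleftrightarrow> (\<forall>j. ((\<lambda>n. X n j) \<longlongrightarrow> x j) F)"
    by (subst limitin_componentwise) auto
  finally show ?thesis .
qed

lemma compact_box_fun:
  "compact {x :: 'a \<Rightarrow> real. \<forall>j. x j \<in> {a..b}}"
proof -
  have "compactin (product_topology (\<lambda>_::'a. euclidean :: real topology) UNIV) (PiE UNIV (\<lambda>_. {a..b}))"
    by (subst compactin_PiE) auto
  then have "compact (PiE (UNIV :: 'a set) (\<lambda>_. {a..b}))"
    by (simp add: euclidean_product_topology)
  moreover have "PiE UNIV (\<lambda>_. {a..b}) = {x :: 'a \<Rightarrow> real. \<forall>j. x j \<in> {a..b}}"
    by (auto simp: PiE_def Pi_def)
  ultimately show ?thesis by simp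
qed

text \<open>The number \<open>n\<close> of coordinates moved by \<open>f\<close> is a variable, so
  the argument runs over functions on the naturals. On every grid Kuhn's lemma finds a cell with,
  for each coordinate, one corner where \<open>f\<close> does not lower it and one where
  \<open>f\<close> does not raise it. At a limit point of these cells continuity gives
  equality.\<close>

lemma brouwer_box_fun:
  fixes f :: "(nat \<Rightarrow> real) \<Rightarrow> nat \<Rightarrow> real" and n :: nat
  assumes ab: "a < b"
    and cont: "\<And>j. j < n \<Longrightarrow> continuous_on {x. \<forall>j. x j \<in> {a..b}} (\<lambda>x. f x j)"
    and maps: "\<And>x j. \<forall>j. x j \<in> {a..b} \<Longrightarrow> j < n \<Longrightarrow> f x j \<in> {a..b}"
  obtains x where "\<forall>j. x j \<in> {a..b}" "\<And>j. j < n \<Longrightarrow> f x j = x j"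
proof -
  define S where "S = {x :: nat \<Rightarrow> real. \<forall>j. x j \<in> {a..b}}"
  \<comment> \<open>Grid points of mesh (b - a) / (N + 1); coordinates from \<open>n\<close> on are
    frozen at \<open>a\<close>.\<close>
  define P where "P N z j = (if j < n then a + (b - a) * (real (z j) / real (Suc N)) else a)"
    for N :: nat and z :: "nat \<Rightarrow> nat" and j
  have P_S: "P N z \<in> S" if "\<And>i. i < n \<Longrightarrow> z i \<le> Suc N" for N z
  proof -
    have "P N z j \<in> {a..b}" for j
    proof (cases "j < n")
      case True
      then have "real (z j) / real (Suc N) \<le> 1"
        using that[OF True] by (simp add: divide_le_eq_1)
      then have "(b - a) * (real (z j) / real (Suc N)) \<le> (b - a) * 1"
        using ab by (intro mult_left_mono) auto
      then show ?thesis using True ab by (auto simp: P_def)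
    qed (use ab in \<open>auto simp: P_def\<close>)
    then show ?thesis by (auto simp: S_def)
  qed
  have "\<exists>q. (\<forall>i<n. q i < Suc N) \<and> (\<forall>i<n. \<exists>r s. (\<forall>j<n. q j \<le> r j \<and> r j \<le> q j + 1) \<and>
      (\<forall>j<n. q j \<le> s j \<and> s j \<le> q j + 1) \<and> P N r i \<le> f (P N r) i \<and> f (P N s) i \<le> P N s i)" for N
  proof -
    \<comment> \<open>Kuhn's lemma demands label 0 on the lower and label 1 on the upper faces. Both
      choices still record how \<open>f\<close> moves the coordinate, because \<open>f\<close> maps
      the box into itself.\<close>
    define label :: "(nat \<Rightarrow> nat) \<Rightarrow> nat \<Rightarrow> nat" where
      "label z i = (if z i = 0 then 0 else if z i = Suc N then 1
         else if P N z i \<le> f (P N z) i then 0 else 1)" for z i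
    have lab0: "P N z i \<le> f (P N z) i" if "label z i = 0" "i < n" "\<And>i. i < n \<Longrightarrow> z i \<le> Suc N" for z i
      using that maps[of "P N z" i] P_S[of z N]
      by (auto simp: label_def S_def P_def split: if_splits)
    have lab1: "f (P N z) i \<le> P N z i" if "label z i = 1" "i < n" "\<And>i. i < n \<Longrightarrow> z i \<le> Suc N" for z i
    proof (cases "z i = Suc N")
      case True
      then have "P N z i = b" using \<open>i < n\<close> by (simp add: P_def)
      then show ?thesis using maps[of "P N z" i] P_S[of z N] that by (auto simp: S_def)
    qed (use that in \<open>auto simp: label_def split: if_splits\<close>)
    obtain q where q: "\<forall>i<n. q i < Suc N"
      "\<forall>i<n. \<exists>r s. (\<forall>j<n. q j \<le> r j \<and> r j \<le> q j + 1) \<and> (\<forall>j<n. q j \<le> s j \<and> s j \<le> q j + 1) \<and>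
         label r i \<noteq> label s i"
      by (rule kuhn_lemma[of "Suc N" n label]) (auto simp: label_def)
    have "\<exists>r s. (\<forall>j<n. q j \<le> r j \<and> r j \<le> q j + 1) \<and>
      (\<forall>j<n. q j \<le> s j \<and> s j \<le> q j + 1) \<and> P N r i \<le> f (P N r) i \<and> f (P N s) i \<le> P N s i"
      if i: "i < n" for i
    proof -
      obtain r s where rs: "\<forall>j<n. q j \<le> r j \<and> r j \<le> q j + 1" "\<forall>j<n. q j \<le> s j \<and> s j \<le> q j + 1"
        "label r i \<noteq> label s i"
        using q(2) i by blast
      have le: "r j \<le> Suc N" "s j \<le> Suc N" if "j < n" for j
        using rs(1,2) q(1) that by (metis Suc_eq_plus1 Suc_leI le_trans Suc_le_mono less_Suc_eq_le)+
      have "label r i = 0 \<and> label s i = 1 \<or> label r i = 1 \<and> label s i = 0"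
        using rs(3) by (auto simp: label_def split: if_splits)
      then show ?thesis
        using rs(1,2) lab0[OF _ i] lab1[OF _ i] le by blast
    qed
    with q(1) show ?thesis by blast
  qed
  then obtain q where q: "\<And>N i. i < n \<Longrightarrow> q N i < Suc N"
    and "\<forall>N. \<forall>i<n. \<exists>r s. (\<forall>j<n. q N j \<le> r j \<and> r j \<le> q N j + 1) \<and>
      (\<forall>j<n. q N j \<le> s j \<and> s j \<le> q N j + 1) \<and> P N r i \<le> f (P N r) i \<and> f (P N s) i \<le> P N s i"
    by metis
  then obtain r s where
    r: "\<And>N i j. i < n \<Longrightarrow> j < n \<Longrightarrow> q N j \<le> r N i j \<and> r N i j \<le> q N j + 1" and
    s: "\<And>N i j. i < n \<Longrightarrow> j < n \<Longrightarrow> q N j \<le> s N i j \<and> s N i j \<le> q N j + 1" and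
    rf: "\<And>N i. i < n \<Longrightarrow> P N (r N i) i \<le> f (P N (r N i)) i" and
    sf: "\<And>N i. i < n \<Longrightarrow> f (P N (s N i)) i \<le> P N (s N i) i"
    by metis
  have "seq_compact S"
    using compact_box_fun[of a b, where 'a = nat] by (simp add: S_def seq_compact_eq_compact)
  moreover have "\<forall>N. P N (q N) \<in> S"
    using q by (auto intro!: P_S simp: less_imp_le)
  ultimately obtain x \<phi> where x: "x \<in> S" and \<phi>: "strict_mono \<phi>"
    and lim: "((\<lambda>N. P N (q N)) \<circ> \<phi>) \<longlonglongrightarrow> x"
    by (rule seq_compactE)
  \<comment> \<open>Corners of a cell lie within one mesh width of its base point, so all of them
    converge along the same subsequence.\<close>
  have near: "(\<lambda>N. P (\<phi> N) (z (\<phi> N))) \<longlonglongrightarrow> x"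
    if z: "\<And>N j. j < n \<Longrightarrow> q N j \<le> z N j \<and> z N j \<le> q N j + 1" for z
    unfolding tendsto_fun_iff
  proof
    fix j
    have *: "(\<lambda>N. P (\<phi> N) (q (\<phi> N)) j) \<longlonglongrightarrow> x j"
      using lim by (auto simp: tendsto_fun_iff o_def)
    have "(\<lambda>N. P N (z N) j - P N (q N) j) \<longlonglongrightarrow> 0"
    proof (rule Lim_null_comparison)
      show "\<forall>\<^sub>F N in sequentially. norm (P N (z N) j - P N (q N) j) \<le> (b - a) * (1 / real (Suc N))"
      proof (rule always_eventually, rule allI)
        fix N
        show "norm (P N (z N) j - P N (q N) j) \<le> (b - a) * (1 / real (Suc N))"
        proof (cases "j < n")
          case True
          have "P N (z N) j - P N (q N) j = (b - a) * ((real (z N j) - real (q N j)) / real (Suc N))"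
            using True by (simp add: P_def diff_divide_distrib right_diff_distrib)
          moreover have "real (z N j) - real (q N j) \<in> {0..1}"
            using z[OF True, of N] by auto
          ultimately show ?thesis
            using ab by (auto simp: abs_mult intro!: mult_left_mono divide_right_mono)
        qed (use ab in \<open>simp add: P_def\<close>)
      qed
      show "(\<lambda>N. (b - a) * (1 / real (Suc N))) \<longlonglongrightarrow> 0"
        by (rule tendsto_mult_right_zero) (use LIMSEQ_inverse_real_of_nat in \<open>simp add: inverse_eq_divide\<close>)
    qed
    then have "(\<lambda>N. P (\<phi> N) (z (\<phi> N)) j - P (\<phi> N) (q (\<phi> N)) j) \<longlonglongrightarrow> 0"
      using \<phi> by (auto dest: LIMSEQ_subseq_LIMSEQ simp: o_def)
    from tendsto_add[OF this *] show "(\<lambda>N. P (\<phi> N) (z (\<phi> N)) j) \<longlonglongrightarrow> x j" by simp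
  qed
  have inS: "P N (z N) \<in> S" if z: "\<And>N j. j < n \<Longrightarrow> q N j \<le> z N j \<and> z N j \<le> q N j + 1" for z N
    using z q by (intro P_S) (metis Suc_eq_plus1 Suc_leI le_trans Suc_le_mono less_Suc_eq_le)
  have flim: "(\<lambda>N. f (P (\<phi> N) (z (\<phi> N))) i) \<longlonglongrightarrow> f x i"
    if z: "\<And>N j. j < n \<Longrightarrow> q N j \<le> z N j \<and> z N j \<le> q N j + 1" and i: "i < n" for z i
    by (rule continuous_on_tendsto_compose[OF cont[OF i] near[OF z]])
       (use x inS[OF z] in \<open>auto simp: S_def\<close>)
  have "f x i = x i" if i: "i < n" for i
  proof (rule antisym)
    have "(\<lambda>N. P (\<phi> N) (s (\<phi> N) i) i) \<longlonglongrightarrow> x i"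
      using near[of "\<lambda>N. s N i"] s[OF i] by (auto simp: tendsto_fun_iff)
    then show "f x i \<le> x i"
      using flim[of "\<lambda>N. s N i", OF s[OF i] i] sf[OF i] by (auto intro: LIMSEQ_le)
    have "(\<lambda>N. P (\<phi> N) (r (\<phi> N) i) i) \<longlonglongrightarrow> x i"
      using near[of "\<lambda>N. r N i"] r[OF i] by (auto simp: tendsto_fun_iff)
    then show "x i \<le> f x i"
      using flim[of "\<lambda>N. r N i", OF r[OF i] i] rf[OF i] by (auto intro: LIMSEQ_le)
  qed
  with x show ?thesis by (intro that[of x]) (auto simp: S_def)
qed

section \<open>One-sided moments\<close>

text \<open>
  With \<open>m a = kt a * (\<kappa> (a+1) - \<kappa> (a-1)) / ((\<kappa> (a+1) - \<kappa> a) * (\<kappa> a - \<kappa> (a-1)))\<close> this is the sum over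
  \<open>a < j\<close> in the system for \<open>G\<close>, with \<open>s \<pi>\<^sub>a G\<^sub>a\<close> eliminated recursively. It is linear in \<open>\<pi>\<close>.
\<close>

function left_moment :: "(nat \<Rightarrow> real) \<Rightarrow> (nat \<Rightarrow> real) \<Rightarrow> (nat \<Rightarrow> real) \<Rightarrow> nat \<Rightarrow> real" where
  "left_moment \<kappa> m \<pi> j = (\<Sum>a\<in>{1..<j}. (\<kappa> j - \<kappa> a) * (\<pi> a + m a * left_moment \<kappa> m \<pi> a))"
  by pat_completeness auto
termination by (relation "Wellfounded.measure (\<lambda>(_, _, _, j). j)") auto

declare left_moment.simps [simp del]

lemma left_moment_1 [simp]: "left_moment \<kappa> m \<pi> (Suc 0) = 0"
  by (subst left_moment.simps) simp

lemma left_moment_nonneg: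
  assumes "strict_mono_on {1..M} \<kappa>" "\<And>a. a \<in> {1..M} \<Longrightarrow> 0 \<le> m a" "\<And>a. a \<in> {1..M} \<Longrightarrow> 0 < \<pi> a"
    and "j \<le> M"
  shows "0 \<le> left_moment \<kappa> m \<pi> j"
  using assms(4)
proof (induction j rule: less_induct)
  case (less j)
  have "0 \<le> (\<kappa> j - \<kappa> a) * (\<pi> a + m a * left_moment \<kappa> m \<pi> a)" if a: "a \<in> {1..<j}" for a
  proof -
    have "\<kappa> a < \<kappa> j" using a less.prems assms(1) by (auto simp: strict_mono_on_def)
    moreover have "0 \<le> \<pi> a + m a * left_moment \<kappa> m \<pi> a"
      using a less assms(2,3)[of a] by (intro add_nonneg_nonneg mult_nonneg_nonneg) auto
    ultimately show ?thesis by simp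
  qed
  then show ?case
    by (subst left_moment.simps) (rule sum_nonneg)
qed

lemma left_moment_weight_pos:
  assumes "strict_mono_on {1..M} \<kappa>" "\<And>a. a \<in> {1..M} \<Longrightarrow> 0 \<le> m a" "\<And>a. a \<in> {1..M} \<Longrightarrow> 0 < \<pi> a"
    and "a \<in> {1..M}"
  shows "0 < \<pi> a + m a * left_moment \<kappa> m \<pi> a"
  using assms(2-4) left_moment_nonneg[of M \<kappa> m \<pi> a] assms(1)
  by (intro add_pos_nonneg mult_nonneg_nonneg) auto

text \<open>Including \<open>a = j\<close> in the sum for \<open>j\<close> costs nothing, as its
  factor is zero; moving the base point to \<open>Suc j\<close> then raises every factor.\<close>

lemma left_moment_less_Suc:
  assumes "strict_mono_on {1..M} \<kappa>" "\<And>a. a \<in> {1..M} \<Longrightarrow> 0 \<le> m a" "\<And>a. a \<in> {1..M} \<Longrightarrow> 0 < \<pi> a"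
    and "1 \<le> j" "j < M"
  shows "left_moment \<kappa> m \<pi> j < left_moment \<kappa> m \<pi> (Suc j)"
proof -
  let ?w = "\<lambda>a. \<pi> a + m a * left_moment \<kappa> m \<pi> a"
  have w: "0 < ?w a" if "a \<in> {1..M}" for a
    by (rule left_moment_weight_pos[of M]) (use assms that in auto)
  have \<kappa>: "\<kappa> j < \<kappa> (Suc j)" using assms by (auto simp: strict_mono_on_def)
  have "left_moment \<kappa> m \<pi> j = (\<Sum>a\<in>{1..<j}. (\<kappa> j - \<kappa> a) * ?w a)"
    by (rule left_moment.simps)
  also have "\<dots> = (\<Sum>a\<in>{1..<Suc j}. (\<kappa> j - \<kappa> a) * ?w a)"
    using assms by simp
  also have "\<dots> < (\<Sum>a\<in>{1..<Suc j}. (\<kappa> (Suc j) - \<kappa> a) * ?w a)"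
    using assms \<kappa> w by (intro sum_strict_mono mult_strict_right_mono) auto
  also have "\<dots> = left_moment \<kappa> m \<pi> (Suc j)"
    by (rule left_moment.simps[symmetric])
  finally show ?thesis .
qed

lemma left_moment_mono:
  assumes "strict_mono_on {1..M} \<kappa>" "\<And>a. a \<in> {1..M} \<Longrightarrow> 0 \<le> m a" "\<And>a. a \<in> {1..M} \<Longrightarrow> 0 < \<pi> a"
    and "1 \<le> j" "j \<le> k" "k \<le> M"
  shows "left_moment \<kappa> m \<pi> j \<le> left_moment \<kappa> m \<pi> k"
  using assms(5,6)
proof (induction k rule: dec_induct)
  case (step n)
  then show ?case using left_moment_less_Suc[of M \<kappa> m \<pi> n] assms by auto
qed simp

text \<open>The point is that \<open>C\<close> does not depend on \<pi>. For a < j the distance from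
  \<open>a\<close> to \<open>j + 1\<close> is at most (diameter / least gap) times that from
  \<open>a\<close> to \<open>j\<close>, which compares consecutive moments up to the new term for
  \<open>j\<close>. Conversely, each site below \<open>j\<close> contributes at least the least gap
  times its mass.\<close>

lemma left_moment_bounds:
  fixes \<kappa> m :: "nat \<Rightarrow> real"
  assumes \<kappa>: "strict_mono_on {1..M} \<kappa>" and m: "\<And>a. a \<in> {1..M} \<Longrightarrow> 0 \<le> m a"
  obtains C where "1 \<le> C"
    and "\<And>\<pi> j. (\<And>a. a \<in> {1..M} \<Longrightarrow> 0 < \<pi> a) \<Longrightarrow> 1 \<le> j \<Longrightarrow> j < M \<Longrightarrow>
      left_moment \<kappa> m \<pi> (Suc j) \<le> C * (left_moment \<kappa> m \<pi> j + \<pi> j)"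
    and "\<And>\<pi> j. (\<And>a. a \<in> {1..M} \<Longrightarrow> 0 < \<pi> a) \<Longrightarrow> 1 \<le> j \<Longrightarrow> j \<le> M \<Longrightarrow>
      (\<Sum>a\<in>{1..<j}. \<pi> a) \<le> C * left_moment \<kappa> m \<pi> j"
proof -
  define g where "g = Min (insert 1 ((\<lambda>j. \<kappa> (Suc j) - \<kappa> j) ` {1..<M}))"
  define D where "D = max 1 (\<kappa> M - \<kappa> 1)"
  define mm where "mm = Max (insert 0 (m ` {1..M}))"
  define C where "C = D / g + D * (1 + mm) + 1 / g + 1"
  have le: "\<kappa> a \<le> \<kappa> b" if "1 \<le> a" "a \<le> b" "b \<le> M" for a b
    using \<kappa> that by (cases "a = b") (auto simp: strict_mono_on_def less_imp_le)
  have g0: "0 < g"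
    unfolding g_def using \<kappa> by (subst Min_gr_iff) (auto simp: strict_mono_on_def)
  have g: "g \<le> \<kappa> b - \<kappa> a" if "1 \<le> a" "a < b" "b \<le> M" for a b
  proof -
    have "g \<le> \<kappa> (Suc a) - \<kappa> a"
      unfolding g_def using that by (intro Min_le) auto
    also have "\<dots> \<le> \<kappa> b - \<kappa> a" using le[of "Suc a" b] that by auto
    finally show ?thesis .
  qed
  have D: "\<kappa> b - \<kappa> a \<le> D" if "1 \<le> a" "a \<le> b" "b \<le> M" for a b
    using le[of 1 a] le[of b M] that by (auto simp: D_def)
  have D0: "1 \<le> D" by (simp add: D_def)
  have mm: "m a \<le> mm" if "a \<in> {1..M}" for a
    unfolding mm_def using that by (intro Max_ge) auto
  have mm0: "0 \<le> mm" unfolding mm_def by (intro Max_ge) auto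
  have nn: "0 \<le> D / g" "0 \<le> D * (1 + mm)" "0 \<le> 1 / g"
    using g0 D0 mm0 by auto
  show thesis
  proof (rule that[of C])
    show "1 \<le> C" using nn by (simp add: C_def)
  next
    fix \<pi> :: "nat \<Rightarrow> real" and j
    assume \<pi>: "\<And>a. a \<in> {1..M} \<Longrightarrow> 0 < \<pi> a" and j: "1 \<le> j" "j < M"
    let ?F = "left_moment \<kappa> m \<pi>"
    let ?w = "\<lambda>a. \<pi> a + m a * ?F a"
    have w: "0 < ?w a" if "a \<in> {1..M}" for a
      by (rule left_moment_weight_pos[of M]) (use \<kappa> m \<pi> that in auto)
    have F: "0 \<le> ?F j" using left_moment_nonneg[of M \<kappa> m \<pi> j] \<kappa> m \<pi> j by auto
    have "?F (Suc j) = (\<Sum>a\<in>{1..<j}. (\<kappa> (Suc j) - \<kappa> a) * ?w a) + (\<kappa> (Suc j) - \<kappa> j) * ?w j"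
      using j by (subst left_moment.simps) simp
    also have "(\<Sum>a\<in>{1..<j}. (\<kappa> (Suc j) - \<kappa> a) * ?w a) \<le> (\<Sum>a\<in>{1..<j}. D / g * ((\<kappa> j - \<kappa> a) * ?w a))"
    proof (rule sum_mono)
      fix a assume a: "a \<in> {1..<j}"
      have "\<kappa> (Suc j) - \<kappa> a \<le> D / g * g" using D[of a "Suc j"] a j g0 by simp
      also have "\<dots> \<le> D / g * (\<kappa> j - \<kappa> a)"
        using g[of a j] a j nn by (intro mult_left_mono) auto
      finally have "(\<kappa> (Suc j) - \<kappa> a) * ?w a \<le> D / g * (\<kappa> j - \<kappa> a) * ?w a"
        using w[of a] a j by (intro mult_right_mono) auto
      then show "(\<kappa> (Suc j) - \<kappa> a) * ?w a \<le> D / g * ((\<kappa> j - \<kappa> a) * ?w a)"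
        by (simp only: mult.assoc)
    qed
    also have "\<dots> = D / g * ?F j"
      by (simp add: sum_distrib_left left_moment.simps[of \<kappa> m \<pi> j])
    also have "(\<kappa> (Suc j) - \<kappa> j) * ?w j \<le> D * (\<pi> j + mm * ?F j)"
      using D[of j "Suc j"] D0 w[of j] j mm[of j] F by (intro mult_mono) (auto intro: mult_right_mono)
    also have "D / g * ?F j + D * (\<pi> j + mm * ?F j) = (D / g + D * mm) * ?F j + D * \<pi> j"
      by (simp add: algebra_simps)
    also have "(D / g + D * mm) * ?F j \<le> C * ?F j"
      using F nn D0 by (intro mult_right_mono) (auto simp: C_def algebra_simps)
    also have "D * \<pi> j \<le> C * \<pi> j"
      using \<pi>[of j] j nn D0 mm0 by (intro mult_right_mono) (auto simp: C_def algebra_simps)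
    finally show "?F (Suc j) \<le> C * (?F j + \<pi> j)" by (simp add: algebra_simps)
  next
    fix \<pi> :: "nat \<Rightarrow> real" and j
    assume \<pi>: "\<And>a. a \<in> {1..M} \<Longrightarrow> 0 < \<pi> a" and j: "1 \<le> j" "j \<le> M"
    let ?F = "left_moment \<kappa> m \<pi>"
    have F: "0 \<le> ?F a" if "a \<le> M" for a using left_moment_nonneg[of M \<kappa> m \<pi> a] \<kappa> m \<pi> that by auto
    have "(\<Sum>a\<in>{1..<j}. \<pi> a) \<le> (\<Sum>a\<in>{1..<j}. 1 / g * ((\<kappa> j - \<kappa> a) * (\<pi> a + m a * ?F a)))"
    proof (rule sum_mono)
      fix a assume a: "a \<in> {1..<j}"
      have "g * \<pi> a \<le> (\<kappa> j - \<kappa> a) * (\<pi> a + m a * ?F a)"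
        using g[of a j] a j g0 \<pi>[of a] m[of a] F[of a] by (intro mult_mono) auto
      then show "\<pi> a \<le> 1 / g * ((\<kappa> j - \<kappa> a) * (\<pi> a + m a * ?F a))"
        using g0 by (simp add: field_simps)
    qed
    also have "\<dots> = 1 / g * ?F j"
      by (simp add: sum_distrib_left left_moment.simps[of \<kappa> m \<pi> j])
    also have "\<dots> \<le> C * ?F j"
      using F[of j] j nn D0 by (intro mult_right_mono) (auto simp: C_def)
    finally show "(\<Sum>a\<in>{1..<j}. \<pi> a) \<le> C * ?F j" .
  qed
qed

lemma continuous_on_left_moment:
  fixes f :: "'a::topological_space \<Rightarrow> nat \<Rightarrow> real"
  assumes "\<And>a. continuous_on S (\<lambda>x. f x a)"
  shows "continuous_on S (\<lambda>x. left_moment \<kappa> m (f x) j)"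
proof (induction j rule: less_induct)
  case (less j)
  show ?case
    by (subst left_moment.simps) (use less assms in \<open>auto intro!: continuous_intros\<close>)
qed

section \<open>Barriers\<close>

text \<open>
  The inequalities shared by the left-hand side and (after reversing the indices) the right-hand
  side of a site: \<open>F\<close> is a one-sided moment, \<open>Y j = s \<lambda>\<^sub>j\<close> and \<open>v n\<close> is the mass distribution after \<open>n\<close> steps.
\<close>

definition leaky_chain ::
  "nat \<Rightarrow> real \<Rightarrow> (nat \<Rightarrow> real) \<Rightarrow> (nat \<Rightarrow> real) \<Rightarrow> (nat \<Rightarrow> real) \<Rightarrow> (nat \<Rightarrow> nat \<Rightarrow> real) \<Rightarrow> bool"
where
  "leaky_chain M C \<pi> Y F v \<longleftrightarrow>
     (\<forall>j\<in>{1..M}. 0 < \<pi> j) \<and> (\<Sum>j=1..M. \<pi> j) = 1 \<and>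
     (\<forall>j\<in>{1..M}. 0 \<le> F j \<and> 0 \<le> Y j \<and> Y j * \<pi> j \<le> C * F j \<and> (\<Sum>a\<in>{1..<j}. \<pi> a) \<le> C * F j) \<and>
     (\<forall>j. 1 \<le> j \<longrightarrow> j < M \<longrightarrow> F (Suc j) \<le> C * (F j + \<pi> j)) \<and>
     (\<forall>n. \<forall>j\<in>{1..M}. 0 \<le> v n j \<and> v n j \<le> 1) \<and> (\<forall>j\<in>{1..M}. v 0 j \<le> \<pi> j) \<and>
     (\<forall>n j. 1 \<le> j \<longrightarrow> j < M \<longrightarrow>
        (\<Sum>c=1..j. v (Suc n) c) \<le> (\<Sum>c=1..j. v n c) + Y (Suc j) * v (Suc n) (Suc j))"

text \<open>Downward induction on \<open>k\<close>, one \<epsilon> serving all \<open>j\<close> in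
  \<open>{k..M}\<close>. At \<open>M\<close> the hypotheses contradict total mass one. At
  \<open>k\<close> the moment at \<open>Suc k\<close> is small as well. If
  \<open>\<pi> (Suc k)\<close> is small too, the induction hypothesis bounds a longer prefix;
  otherwise \<open>Y (Suc k)\<close> is small and \<open>Suc k\<close> is a barrier that lets little
  mass through in \<open>r\<close> steps.\<close>

lemma leaky_chain_mass_small:
  assumes C: "1 \<le> C" and \<eta>: "0 < \<eta>" and M: "1 \<le> M"
  obtains \<epsilon> where "0 < \<epsilon>"
    and "\<And>\<pi> Y F v j n. leaky_chain M C \<pi> Y F v \<Longrightarrow> j \<in> {1..M} \<Longrightarrow> F j \<le> \<epsilon> \<Longrightarrow> \<pi> j \<le> \<epsilon> \<Longrightarrow>
      n \<le> r \<Longrightarrow> (\<Sum>c=1..j. v n c) \<le> \<eta>"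
proof -
  have "\<exists>\<epsilon>>0. \<forall>\<pi> Y F v n. \<forall>j\<in>{k..M}. leaky_chain M C \<pi> Y F v \<longrightarrow> F j \<le> \<epsilon> \<longrightarrow> \<pi> j \<le> \<epsilon> \<longrightarrow>
      n \<le> r \<longrightarrow> (\<Sum>c=1..j. v n c) \<le> \<eta>" if "k \<le> M" "1 \<le> k" for k
    using that
  proof (induction k rule: inc_induct)
    case base
    define \<epsilon> where "\<epsilon> = 1 / (2 * (C + 1))"
    have \<epsilon>: "0 < \<epsilon>" "(C + 1) * \<epsilon> < 1" using C by (auto simp: \<epsilon>_def)
    have False if L: "leaky_chain M C \<pi> Y F v" "F M \<le> \<epsilon>" "\<pi> M \<le> \<epsilon>" for \<pi> Y F v
    proof -
      have "1 = (\<Sum>a\<in>{1..<M}. \<pi> a) + \<pi> M"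
        using L M by (auto simp: leaky_chain_def sum.last_plus add.commute)
      also have "(\<Sum>a\<in>{1..<M}. \<pi> a) \<le> C * F M"
        using L M by (auto simp: leaky_chain_def)
      also have "C * F M \<le> C * \<epsilon>" using L C by (intro mult_left_mono) auto
      finally have "1 \<le> (C + 1) * \<epsilon>" using L by (simp add: algebra_simps)
      with \<epsilon> show False by simp
    qed
    with \<epsilon> show ?case by (intro exI[of _ \<epsilon>]) auto
  next
    case (step k)
    then obtain \<epsilon>1 where \<epsilon>1: "0 < \<epsilon>1" and IH: "\<And>\<pi> Y F v n j. j \<in> {Suc k..M} \<Longrightarrow> leaky_chain M C \<pi> Y F v \<Longrightarrow>
      F j \<le> \<epsilon>1 \<Longrightarrow> \<pi> j \<le> \<epsilon>1 \<Longrightarrow> n \<le> r \<Longrightarrow> (\<Sum>c=1..j. v n c) \<le> \<eta>"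
      by auto
    \<comment> \<open>\<open>B * \<epsilon>\<close> collects the initial mass of the prefix, at most
      \<open>C * \<epsilon> + \<epsilon>\<close>, and \<open>r\<close> crossings of at most
      \<open>2 * C * C / \<epsilon>1 * \<epsilon>\<close> each. The term
      \<open>\<epsilon>1 / (2 * C)\<close> in the minimum below keeps \<open>F (Suc k)\<close> under
      \<open>\<epsilon>1\<close>.\<close>
    define B where "B = C + 1 + real r * (2 * C * C / \<epsilon>1)"
    have B: "0 < B" using C \<epsilon>1 by (auto simp: B_def intro!: add_pos_nonneg)
    define \<epsilon> where "\<epsilon> = min \<epsilon>1 (min (\<epsilon>1 / (2 * C)) (\<eta> / B))"
    have \<epsilon>: "0 < \<epsilon>" "\<epsilon> \<le> \<epsilon>1" "2 * C * \<epsilon> \<le> \<epsilon>1" "B * \<epsilon> \<le> \<eta>"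
    proof -
      show "0 < \<epsilon>" "\<epsilon> \<le> \<epsilon>1" using \<epsilon>1 \<eta> B C by (auto simp: \<epsilon>_def)
      have "2 * C * \<epsilon> \<le> 2 * C * (\<epsilon>1 / (2 * C))" using C by (intro mult_left_mono) (auto simp: \<epsilon>_def)
      then show "2 * C * \<epsilon> \<le> \<epsilon>1" using C by simp
      have "B * \<epsilon> \<le> B * (\<eta> / B)" using B by (intro mult_left_mono) (auto simp: \<epsilon>_def)
      then show "B * \<epsilon> \<le> \<eta>" using B by simp
    qed
    have "(\<Sum>c=1..k. v n c) \<le> \<eta>"
      if L: "leaky_chain M C \<pi> Y F v" and Fk: "F k \<le> \<epsilon>" and \<pi>k: "\<pi> k \<le> \<epsilon>" and n: "n \<le> r" for \<pi> Y F v n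
    proof -
      have k: "k \<in> {1..M}" "Suc k \<in> {1..M}" "1 \<le> k" "k < M" using step by auto
      have v0: "0 \<le> v n j" "v n j \<le> 1" if "j \<in> {1..M}" for n j
        using L that by (auto simp: leaky_chain_def)
      have "F (Suc k) \<le> C * (F k + \<pi> k)" using L k by (auto simp: leaky_chain_def)
      also have "\<dots> \<le> C * (\<epsilon> + \<epsilon>)" using Fk \<pi>k C by (intro mult_left_mono) auto
      finally have F: "F (Suc k) \<le> 2 * C * \<epsilon>" by simp
      show ?thesis
      proof (cases "\<pi> (Suc k) \<le> \<epsilon>1")
        case True
        have "(\<Sum>c=1..k. v n c) \<le> (\<Sum>c=1..Suc k. v n c)"
          using v0[OF k(2)] by simp
        also have "\<dots> \<le> \<eta>"
          using IH[OF _ L _ True n] F \<epsilon> k by auto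
        finally show ?thesis .
      next
        case False
        define y where "y = 2 * C * C / \<epsilon>1 * \<epsilon>"
        have Y0: "0 \<le> Y (Suc k)" using L k by (auto simp: leaky_chain_def)
        have "Y (Suc k) * \<epsilon>1 \<le> Y (Suc k) * \<pi> (Suc k)"
          using False Y0 by (intro mult_left_mono) auto
        also have "\<dots> \<le> C * F (Suc k)" using L k by (auto simp: leaky_chain_def)
        also have "\<dots> \<le> C * (2 * C * \<epsilon>)" using F C by (intro mult_left_mono) auto
        finally have Y: "Y (Suc k) \<le> y" using \<epsilon>1 by (simp add: y_def field_simps)
        have y0: "0 \<le> y" using Y Y0 by simp
        have "(\<Sum>c=1..k. v n c) \<le> (\<Sum>c=1..k. \<pi> c) + real n * y" for n
        proof (induction n)
          case 0
          show ?case using L k by (auto simp: leaky_chain_def intro!: sum_mono)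
        next
          case (Suc n)
          have "(\<Sum>c=1..k. v (Suc n) c) \<le> (\<Sum>c=1..k. v n c) + Y (Suc k) * v (Suc n) (Suc k)"
            using L k by (auto simp: leaky_chain_def)
          also have "Y (Suc k) * v (Suc n) (Suc k) \<le> y * 1"
            using Y y0 v0[OF k(2)] by (intro mult_mono) auto
          finally show ?case using Suc by (simp add: algebra_simps)
        qed
        from this[of n] have "(\<Sum>c=1..k. v n c) \<le> (\<Sum>c=1..k. \<pi> c) + real n * y" .
        also have "real n * y \<le> real r * y" using n y0 by (intro mult_right_mono) auto
        also have "(\<Sum>c=1..k. \<pi> c) = (\<Sum>c\<in>{1..<k}. \<pi> c) + \<pi> k"
          using k by (simp add: sum.last_plus add.commute)
        also have "(\<Sum>c\<in>{1..<k}. \<pi> c) \<le> C * F k" using L k by (auto simp: leaky_chain_def)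
        also have "C * F k \<le> C * \<epsilon>" using Fk C by (intro mult_left_mono) auto
        also have "\<pi> k \<le> \<epsilon>" by fact
        also have "C * \<epsilon> + \<epsilon> + real r * y = B * \<epsilon>" by (simp add: B_def y_def algebra_simps)
        also have "\<dots> \<le> \<eta>" by fact
        finally show ?thesis by simp
      qed
    qed
    note new = this
    have "(\<Sum>c=1..j. v n c) \<le> \<eta>"
      if "j \<in> {k..M}" "leaky_chain M C \<pi> Y F v" "F j \<le> \<epsilon>" "\<pi> j \<le> \<epsilon>" "n \<le> r" for \<pi> Y F v n j
    proof (cases "j = k")
      case True
      then show ?thesis using new[of \<pi> Y F v n] that by auto
    next
      case False
      then show ?thesis using IH[of j \<pi> Y F v n] that \<epsilon> by auto
    qed
    then show ?case using \<epsilon> by (intro exI[of _ \<epsilon>]) auto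
  qed
  from this[of 1] M show thesis using that by auto
qed

section \<open>Tridiagonal systems\<close>

text \<open>Forward elimination and back substitution for the tridiagonal system
  \<open>d c * v c - \<alpha> (c - 1) * v (c - 1) - \<beta> (c + 1) * v (c + 1) = u c\<close>, \<open>1 \<le> c \<le> M\<close>.\<close>

primrec pivot :: "(nat \<Rightarrow> real) \<Rightarrow> (nat \<Rightarrow> real) \<Rightarrow> (nat \<Rightarrow> real) \<Rightarrow> nat \<Rightarrow> real" where
  "pivot d \<alpha> \<beta> 0 = 1"
| "pivot d \<alpha> \<beta> (Suc c) = d (Suc c) - \<alpha> c * \<beta> (Suc c) / pivot d \<alpha> \<beta> c"

primrec elim_rhs :: "(nat \<Rightarrow> real) \<Rightarrow> (nat \<Rightarrow> real) \<Rightarrow> (nat \<Rightarrow> real) \<Rightarrow> (nat \<Rightarrow> real) \<Rightarrow> nat \<Rightarrow> real" where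
  "elim_rhs d \<alpha> \<beta> u 0 = 0"
| "elim_rhs d \<alpha> \<beta> u (Suc c) = u (Suc c) + \<alpha> c * elim_rhs d \<alpha> \<beta> u c / pivot d \<alpha> \<beta> c"

primrec back_subst ::
  "nat \<Rightarrow> (nat \<Rightarrow> real) \<Rightarrow> (nat \<Rightarrow> real) \<Rightarrow> (nat \<Rightarrow> real) \<Rightarrow> (nat \<Rightarrow> real) \<Rightarrow> nat \<Rightarrow> real"
where
  "back_subst M d \<alpha> \<beta> u 0 = elim_rhs d \<alpha> \<beta> u M / pivot d \<alpha> \<beta> M"
| "back_subst M d \<alpha> \<beta> u (Suc n) =
     (elim_rhs d \<alpha> \<beta> u (M - Suc n) + \<beta> (M - n) * back_subst M d \<alpha> \<beta> u n) / pivot d \<alpha> \<beta> (M - Suc n)"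

definition tridiag_solve ::
  "nat \<Rightarrow> (nat \<Rightarrow> real) \<Rightarrow> (nat \<Rightarrow> real) \<Rightarrow> (nat \<Rightarrow> real) \<Rightarrow> (nat \<Rightarrow> real) \<Rightarrow> nat \<Rightarrow> real"
where
  "tridiag_solve M d \<alpha> \<beta> u c = back_subst M d \<alpha> \<beta> u (M - c)"

text \<open>Diagonal dominance survives elimination: as the pivot at \<open>c\<close> is at least
  \<open>\<alpha> c\<close>, the correction at \<open>Suc c\<close> is at most
  \<open>\<beta> (Suc c)\<close>, which leaves \<open>1 + \<alpha> (Suc c)\<close>.\<close>

lemma pivot_ge:
  assumes "\<And>c. 0 \<le> \<alpha> c" "\<And>c. 0 \<le> \<beta> c" "\<alpha> 0 = 0" "\<And>c. 1 + \<alpha> c + \<beta> c \<le> d c"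
  shows "1 + \<alpha> c \<le> pivot d \<alpha> \<beta> c"
proof (induction c)
  case (Suc c)
  have "\<alpha> c / pivot d \<alpha> \<beta> c \<le> 1"
    using Suc assms(1)[of c] by (simp add: divide_le_eq_1)
  then have "\<alpha> c / pivot d \<alpha> \<beta> c * \<beta> (Suc c) \<le> 1 * \<beta> (Suc c)"
    using assms(2) by (intro mult_right_mono) auto
  then show ?case using assms(4)[of "Suc c"] by simp
qed (use assms in simp)

lemma pivot_pos:
  assumes "\<And>c. 0 \<le> \<alpha> c" "\<And>c. 0 \<le> \<beta> c" "\<alpha> 0 = 0" "\<And>c. 1 + \<alpha> c + \<beta> c \<le> d c"
  shows "0 < pivot d \<alpha> \<beta> c"
  using pivot_ge[of \<alpha> \<beta> d c] assms(1)[of c] assms by fastforce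

text \<open>With positive pivots, elimination and back substitution only ever add nonnegative terms
  to the right-hand side.\<close>

lemma tridiag_solve_pos:
  assumes "\<And>c. 0 \<le> \<alpha> c" "\<And>c. 0 \<le> \<beta> c" "\<alpha> 0 = 0" "\<And>c. 1 + \<alpha> c + \<beta> c \<le> d c"
    and u: "\<And>c. c \<in> {1..M} \<Longrightarrow> 0 < u c" and c: "c \<in> {1..M}"
  shows "0 < tridiag_solve M d \<alpha> \<beta> u c"
proof -
  have piv: "0 < pivot d \<alpha> \<beta> c" for c
    by (rule pivot_pos) (use assms in auto)
  have rhs0: "c \<le> M \<Longrightarrow> 0 \<le> elim_rhs d \<alpha> \<beta> u c" for c
  proof (induction c)
    case (Suc c)
    then show ?case using assms(1)[of c] piv[of c] u[of "Suc c"] by (auto intro!: add_nonneg_nonneg)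
  qed simp
  have rhs: "0 < elim_rhs d \<alpha> \<beta> u c" if "c \<in> {1..M}" for c
  proof (cases c)
    case (Suc n)
    then show ?thesis using that rhs0[of n] assms(1)[of n] piv[of n] u[of c] by (auto intro!: add_pos_nonneg)
  qed (use that in auto)
  have "n < M \<Longrightarrow> 0 < back_subst M d \<alpha> \<beta> u n" for n
  proof (induction n)
    case 0
    then show ?case using rhs[of M] piv[of M] by auto
  next
    case (Suc n)
    then show ?case using rhs[of "M - Suc n"] piv[of "M - Suc n"] assms(2)[of "M - n"]
      by (auto intro!: add_pos_nonneg divide_pos_pos)
  qed
  from this[of "M - c"] c show ?thesis by (auto simp: tridiag_solve_def)
qed

text \<open>Back substitution gives the relation \<open>bs\<close> between neighbours; using it at
  \<open>c\<close> and \<open>c - 1\<close> undoes the elimination of row \<open>c\<close>. Index 0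
  is included in \<open>bs\<close> so that row 1 needs no separate case: there
  \<open>\<alpha> 0 = 0\<close> removes the fictitious entry \<open>v 0\<close>.\<close>

lemma tridiag_solve_eq:
  fixes d \<alpha> \<beta> u :: "nat \<Rightarrow> real"
  assumes "\<And>c. 0 \<le> \<alpha> c" "\<And>c. 0 \<le> \<beta> c" "\<alpha> 0 = 0" "\<And>c. 1 + \<alpha> c + \<beta> c \<le> d c"
    and \<beta>: "\<beta> (Suc M) = 0" and c: "c \<in> {1..M}"
  defines "v \<equiv> tridiag_solve M d \<alpha> \<beta> u"
  shows "d c * v c - \<alpha> (c - 1) * v (c - 1) - \<beta> (c + 1) * v (c + 1) = u c"
proof -
  let ?p = "pivot d \<alpha> \<beta>" and ?r = "elim_rhs d \<alpha> \<beta> u"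
  have piv: "?p c > 0" for c
    by (rule pivot_pos) (use assms in auto)
  have bs: "?p c * v c = ?r c + \<beta> (c + 1) * v (c + 1)" if "c \<le> M" for c
  proof (cases "c = M")
    case True
    then show ?thesis using piv[of M] \<beta> by (simp add: v_def tridiag_solve_def)
  next
    case False
    then have "M - c = Suc (M - Suc c)" using that by simp
    moreover have "M - Suc (M - Suc c) = c" "M - (M - Suc c) = Suc c" using that False by auto
    ultimately show ?thesis using piv[of c] by (simp add: v_def tridiag_solve_def)
  qed
  obtain n where n: "c = Suc n" using c by (cases c) auto
  have 1: "?p n * v n = ?r n + \<beta> c * v c" using bs[of n] c n by simp
  have "d c * v c = ?p c * v c + \<alpha> n * (\<beta> c * v c) / ?p n"
    using n by (simp add: algebra_simps)
  also have "\<dots> = ?r c + \<beta> (c + 1) * v (c + 1) + \<alpha> n * (\<beta> c * v c) / ?p n"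
    using bs[of c] c by simp
  also have "?r c = u c + \<alpha> n * ?r n / ?p n" using n by simp
  also have "u c + \<alpha> n * ?r n / ?p n + \<beta> (c + 1) * v (c + 1) + \<alpha> n * (\<beta> c * v c) / ?p n
      = u c + \<beta> (c + 1) * v (c + 1) + \<alpha> n * (?r n + \<beta> c * v c) / ?p n"
    by (simp add: add_divide_distrib distrib_left)
  also have "\<dots> = u c + \<beta> (c + 1) * v (c + 1) + \<alpha> n * v n"
    using piv[of n] unfolding 1[symmetric] by simp
  finally show ?thesis using n by simp
qed

lemma continuous_on_tridiag_solve:
  fixes d \<alpha> \<beta> u :: "'a::topological_space \<Rightarrow> nat \<Rightarrow> real"
  assumes "\<And>x c. x \<in> S \<Longrightarrow> 0 \<le> \<alpha> x c" "\<And>x c. x \<in> S \<Longrightarrow> 0 \<le> \<beta> x c" "\<And>x. x \<in> S \<Longrightarrow> \<alpha> x 0 = 0"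
    "\<And>x c. x \<in> S \<Longrightarrow> 1 + \<alpha> x c + \<beta> x c \<le> d x c"
    and cont: "\<And>c. continuous_on S (\<lambda>x. d x c)" "\<And>c. continuous_on S (\<lambda>x. \<alpha> x c)"
      "\<And>c. continuous_on S (\<lambda>x. \<beta> x c)" "\<And>c. continuous_on S (\<lambda>x. u x c)"
  shows "continuous_on S (\<lambda>x. tridiag_solve M (d x) (\<alpha> x) (\<beta> x) (u x) c)"
proof -
  have piv: "pivot (d x) (\<alpha> x) (\<beta> x) c \<noteq> 0" if "x \<in> S" for x c
    using pivot_pos[of "\<alpha> x" "\<beta> x" "d x" c] assms(1-4)[OF that] by fastforce
  have cp: "continuous_on S (\<lambda>x. pivot (d x) (\<alpha> x) (\<beta> x) c)" for c
    by (induction c) (use piv in \<open>auto intro!: continuous_intros cont\<close>)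
  have cr: "continuous_on S (\<lambda>x. elim_rhs (d x) (\<alpha> x) (\<beta> x) (u x) c)" for c
    by (induction c) (use piv in \<open>auto intro!: continuous_intros cont cp\<close>)
  have "continuous_on S (\<lambda>x. back_subst M (d x) (\<alpha> x) (\<beta> x) (u x) n)" for n
    by (induction n) (use piv in \<open>auto intro!: continuous_intros cont cp cr\<close>)
  then show ?thesis by (simp add: tridiag_solve_def)
qed

section \<open>The killed walk\<close>

text \<open>\<open>qu\<close> and \<open>qd\<close> are the jump probabilities up and down,
  \<open>kt\<close> is the killing rate relative to the jump rate.\<close>

locale killed_walk =
  fixes M :: nat and \<kappa> kt qu qd :: "nat \<Rightarrow> real"
  assumes M: "3 \<le> M"
    and \<kappa>: "strict_mono_on {1..M} \<kappa>"
    and kt: "\<And>j. j \<in> {1..M} \<Longrightarrow> 0 \<le> kt j"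
    and qu: "\<And>j. j \<in> {2..M - 1} \<Longrightarrow> 0 < qu j"
    and qd: "\<And>j. j \<in> {2..M - 1} \<Longrightarrow> 0 < qd j"
    and q1: "\<And>j. j \<in> {2..M - 1} \<Longrightarrow> qu j + qd j = 1"
begin

text \<open>The value zero at the sites 1 and \<open>M\<close> builds the boundary condition of the
  system for G into \<open>Y\<close>.\<close>

definition coef :: "nat \<Rightarrow> real" where
  "coef j = (if j \<in> {2..M - 1}
     then (\<kappa> (j + 1) - \<kappa> (j - 1)) / ((\<kappa> (j + 1) - \<kappa> j) * (\<kappa> j - \<kappa> (j - 1))) else 0)"

definition mcoef :: "nat \<Rightarrow> real" where
  "mcoef a = kt a * coef a"

definition FL :: "(nat \<Rightarrow> real) \<Rightarrow> nat \<Rightarrow> real" where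
  "FL \<pi> = left_moment \<kappa> mcoef \<pi>"

text \<open>The left moment of the reflected chain; negating \<kappa> keeps the reflected
  coordinates increasing.\<close>

definition FR :: "(nat \<Rightarrow> real) \<Rightarrow> nat \<Rightarrow> real" where
  "FR \<pi> j = left_moment (\<lambda>a. - \<kappa> (M + 1 - a)) (\<lambda>a. mcoef (M + 1 - a)) (\<lambda>a. \<pi> (M + 1 - a)) (M + 1 - j)"

text \<open>
  This is \<open>s G\<^sub>j(s, \<pi>)\<close>: the left moment increases and the right moment decreases in \<open>j\<close>, and
  the index \<open>l\<close> is where they cross, so that the minimum selects the prescribed case.
\<close>

definition Y :: "(nat \<Rightarrow> real) \<Rightarrow> nat \<Rightarrow> real" where
  "Y \<pi> j = coef j * min (FL \<pi> j) (FR \<pi> j) / \<pi> j"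

text \<open>With N the matrix of the problem for s \<lambda> = \<open>Y \<pi>\<close>, the second
  clause solves \<open>v \<pi> (Suc n)\<close> N = \<open>v \<pi> n\<close>: per unit of mass, site
  \<open>c\<close> sends \<open>Y \<pi> c * qu c\<close> up and \<open>Y \<pi> c * qd c\<close>
  down. Increasing \<open>n\<close> thus runs the iteration of h backwards.\<close>

primrec v :: "(nat \<Rightarrow> real) \<Rightarrow> nat \<Rightarrow> nat \<Rightarrow> real" where
  "v \<pi> 0 = (\<lambda>j. \<pi> j / (1 + kt j * Y \<pi> j))"
| "v \<pi> (Suc n) = tridiag_solve M (\<lambda>c. 1 + Y \<pi> c * (1 + kt c)) (\<lambda>c. Y \<pi> c * qu c) (\<lambda>c. Y \<pi> c * qd c) (v \<pi> n)"

section \<open>Signs and monotonicity of the moments; identification of \<open>Y\<close> with s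
  G\<close>

lemma \<kappa>_less: "1 \<le> a \<Longrightarrow> a < b \<Longrightarrow> b \<le> M \<Longrightarrow> \<kappa> a < \<kappa> b"
  using \<kappa> by (auto simp: strict_mono_on_def)

lemma coef_pos: "j \<in> {2..M - 1} \<Longrightarrow> 0 < coef j"
  using \<kappa>_less[of j "j + 1"] \<kappa>_less[of "j - 1" j] \<kappa>_less[of "j - 1" "j + 1"]
  by (auto simp: coef_def intro!: divide_pos_pos mult_pos_pos)

lemma coef_nonneg: "0 \<le> coef j"
  using coef_pos[of j] by (cases "j \<in> {2..M - 1}") (auto simp: coef_def)

lemma mcoef_nonneg: "j \<in> {1..M} \<Longrightarrow> 0 \<le> mcoef j"
  using kt coef_nonneg by (simp add: mcoef_def)

lemma mono_reflected: "strict_mono_on {1..M} (\<lambda>a. - \<kappa> (M + 1 - a))"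
  by (auto simp: strict_mono_on_def intro!: \<kappa>_less)

lemma mcoef_reflected_nonneg: "j \<in> {1..M} \<Longrightarrow> 0 \<le> mcoef (M + 1 - j)"
  by (rule mcoef_nonneg) auto

lemma simplex_pos: "\<pi> \<in> prob_simplex M \<Longrightarrow> j \<in> {1..M} \<Longrightarrow> 0 < \<pi> j"
  by (simp add: prob_simplex_def)

lemma simplex_reflected_pos: "\<pi> \<in> prob_simplex M \<Longrightarrow> j \<in> {1..M} \<Longrightarrow> 0 < \<pi> (M + 1 - j)"
  by (rule simplex_pos) auto

lemma FL_eq: "FL \<pi> j = (\<Sum>a\<in>{1..<j}. (\<kappa> j - \<kappa> a) * (\<pi> a + mcoef a * FL \<pi> a))"
  unfolding FL_def by (rule left_moment.simps)

lemma FR_eq: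
  assumes "j \<in> {1..M}"
  shows "FR \<pi> j = (\<Sum>a=j + 1..M. (\<kappa> a - \<kappa> j) * (\<pi> a + mcoef a * FR \<pi> a))"
proof -
  let ?F = "left_moment (\<lambda>a. - \<kappa> (M + 1 - a)) (\<lambda>a. mcoef (M + 1 - a)) (\<lambda>a. \<pi> (M + 1 - a))"
  have "FR \<pi> j = (\<Sum>a\<in>{1..<M + 1 - j}. (- \<kappa> (M + 1 - (M + 1 - j)) - - \<kappa> (M + 1 - a)) *
      (\<pi> (M + 1 - a) + mcoef (M + 1 - a) * ?F a))"
    unfolding FR_def by (rule left_moment.simps)
  also have "\<dots> = (\<Sum>a=j + 1..M. (\<kappa> a - \<kappa> j) * (\<pi> a + mcoef a * FR \<pi> a))"
    by (rule sum.reindex_bij_witness[where i = "\<lambda>a. M + 1 - a" and j = "\<lambda>a. M + 1 - a"])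
       (use assms in \<open>auto simp: FR_def\<close>)
  finally show ?thesis .
qed

lemma FL_nonneg: "\<pi> \<in> prob_simplex M \<Longrightarrow> j \<le> M \<Longrightarrow> 0 \<le> FL \<pi> j"
  unfolding FL_def by (rule left_moment_nonneg[OF \<kappa>]) (auto intro: mcoef_nonneg simplex_pos)

lemma FR_nonneg: "\<pi> \<in> prob_simplex M \<Longrightarrow> 1 \<le> j \<Longrightarrow> 0 \<le> FR \<pi> j"
  unfolding FR_def
  by (rule left_moment_nonneg[OF mono_reflected]) (use mcoef_reflected_nonneg simplex_reflected_pos in auto)

lemma FL_1 [simp]: "FL \<pi> (Suc 0) = 0"
  by (simp add: FL_def)

lemma FR_M [simp]: "FR \<pi> M = 0"
  by (simp add: FR_def)

lemma FL_mono: "\<pi> \<in> prob_simplex M \<Longrightarrow> 1 \<le> a \<Longrightarrow> a \<le> b \<Longrightarrow> b \<le> M \<Longrightarrow> FL \<pi> a \<le> FL \<pi> b"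
  unfolding FL_def by (rule left_moment_mono[OF \<kappa>]) (auto intro: mcoef_nonneg simplex_pos)

lemma FR_antimono: "\<pi> \<in> prob_simplex M \<Longrightarrow> 1 \<le> a \<Longrightarrow> a \<le> b \<Longrightarrow> b \<le> M \<Longrightarrow> FR \<pi> b \<le> FR \<pi> a"
  unfolding FR_def
  by (rule left_moment_mono[OF mono_reflected]) (use mcoef_reflected_nonneg simplex_reflected_pos in auto)

text \<open>This keeps the crossing index \<open>l\<close> of \<open>G_system_Y\<close> away from 1.
  Strictness comes from the single step from \<open>M\<close> to \<open>M - 1\<close>.\<close>

lemma FR_1_pos: "\<pi> \<in> prob_simplex M \<Longrightarrow> 0 < FR \<pi> (Suc 0)"
proof -
  assume \<pi>: "\<pi> \<in> prob_simplex M"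
  have "FR \<pi> M < FR \<pi> (M - 1)"
    unfolding FR_def
    using M left_moment_less_Suc[OF mono_reflected, of "\<lambda>a. mcoef (M + 1 - a)" "\<lambda>a. \<pi> (M + 1 - a)" 1]
      mcoef_reflected_nonneg simplex_reflected_pos[OF \<pi>] by (auto simp: Suc_diff_Suc numeral_2_eq_2)
  also have "\<dots> \<le> FR \<pi> 1" using \<pi> M by (intro FR_antimono) auto
  finally show ?thesis by simp
qed

lemma coef_outside: "j \<notin> {2..M - 1} \<Longrightarrow> coef j = 0"
  unfolding coef_def by (rule if_not_P)

lemma Y_nonneg: "\<pi> \<in> prob_simplex M \<Longrightarrow> 0 \<le> Y \<pi> j"
  using coef_nonneg[of j] coef_outside[of j] FL_nonneg[of \<pi> j] FR_nonneg[of \<pi> j] simplex_pos[of \<pi> j]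
  by (cases "j \<in> {2..M - 1}") (auto simp: Y_def intro!: divide_nonneg_pos mult_nonneg_nonneg)

lemma Y_outside: "j \<notin> {2..M - 1} \<Longrightarrow> Y \<pi> j = 0"
  by (simp add: Y_def coef_outside)

lemma Y_times: "\<pi> \<in> prob_simplex M \<Longrightarrow> j \<in> {1..M} \<Longrightarrow> Y \<pi> j * \<pi> j = coef j * min (FL \<pi> j) (FR \<pi> j)"
  using simplex_pos[of \<pi> j] by (simp add: Y_def)

text \<open>Below the first crossing \<open>l\<close> the minimum in \<open>Y\<close> is the left
  moment, from \<open>l\<close> on the right one, so \<open>FL_eq\<close> and \<open>FR_eq\<close>
  become the two cases of the system. The first moment of the weights about
  \<open>\<kappa> x\<close> is \<open>FR \<pi> x - FL \<pi> x\<close> for x = l - 1 and x = l, and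
  its change of sign places the mean in the required interval.\<close>

lemma G_system_Y:
  assumes \<pi>: "\<pi> \<in> prob_simplex M" and s: "0 < s"
  shows "G_system M \<kappa> kt s \<pi> (\<lambda>j. Y \<pi> j / s)"
proof -
  let ?w = "\<lambda>a. \<pi> a * (1 + s * (Y \<pi> a / s) * kt a)"
  have w: "?w a = \<pi> a + mcoef a * min (FL \<pi> a) (FR \<pi> a)" if "a \<in> {1..M}" for a
  proof -
    have "?w a = \<pi> a + kt a * (Y \<pi> a * \<pi> a)" using s by (simp add: algebra_simps)
    then show ?thesis unfolding Y_times[OF \<pi> that] by (simp add: mcoef_def)
  qed
  have wpos: "0 < ?w a" if "a \<in> {1..M}" for a
    using that s simplex_pos[OF \<pi> that] Y_nonneg[OF \<pi>, of a] kt[OF that]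
    by (auto intro!: mult_pos_pos add_pos_nonneg)
  define l where "l = (LEAST j. 1 \<le> j \<and> FR \<pi> j \<le> FL \<pi> j)"
  have PM: "1 \<le> M \<and> FR \<pi> M \<le> FL \<pi> M" using M FL_nonneg[OF \<pi>, of M] by simp
  have l: "1 \<le> l" "FR \<pi> l \<le> FL \<pi> l"
    unfolding l_def using LeastI[where P = "\<lambda>j. 1 \<le> j \<and> FR \<pi> j \<le> FL \<pi> j", OF PM] by auto
  have lM: "l \<le> M"
    unfolding l_def by (rule Least_le[where P = "\<lambda>j. 1 \<le> j \<and> FR \<pi> j \<le> FL \<pi> j", OF PM])
  have "l \<noteq> 1" using l FR_1_pos[OF \<pi>] by auto
  with l lM have l2: "l \<in> {2..M}" by auto
  have below: "FL \<pi> j < FR \<pi> j" if "1 \<le> j" "j < l" for j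
    using not_less_Least[of j "\<lambda>j. 1 \<le> j \<and> FR \<pi> j \<le> FL \<pi> j"] that unfolding l_def[symmetric] by auto
  have above: "FR \<pi> j \<le> FL \<pi> j" if "l \<le> j" "j \<le> M" for j
    using FL_mono[OF \<pi> _ that] FR_antimono[OF \<pi> _ that] l by auto
  have mass_left: "(\<kappa> j - \<kappa> a) * ?w a = (\<kappa> j - \<kappa> a) * (\<pi> a + mcoef a * FL \<pi> a)"
    if "a \<in> {1..<l}" for a j
    using w[of a] that below[of a] lM by auto
  have mass_right: "(\<kappa> a - \<kappa> j) * ?w a = (\<kappa> a - \<kappa> j) * (\<pi> a + mcoef a * FR \<pi> a)"
    if "a \<in> {l..M}" for a j
    using w[of a] that above[of a] l by auto
  \<comment> \<open>Recutting the two sums at \<open>x\<close> instead of \<open>l\<close> only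
    affects the term of \<open>x\<close> itself, whose factor is zero.\<close>
  have moment: "(\<Sum>a=1..M. \<kappa> a * ?w a) - \<kappa> x * (\<Sum>a=1..M. ?w a) = FR \<pi> x - FL \<pi> x"
    if x: "x = l \<or> x = l - 1" for x
  proof -
    have "(\<Sum>a=1..M. \<kappa> a * ?w a) - \<kappa> x * (\<Sum>a=1..M. ?w a) = (\<Sum>a=1..M. (\<kappa> a - \<kappa> x) * ?w a)"
      by (simp add: sum_distrib_left sum_subtractf left_diff_distrib)
    also have "\<dots> = (\<Sum>a\<in>{1..<l} \<union> {l..M}. (\<kappa> a - \<kappa> x) * ?w a)"
      using l2 by (intro sum.cong) auto
    also have "\<dots> = (\<Sum>a\<in>{1..<l}. (\<kappa> a - \<kappa> x) * ?w a) + (\<Sum>a=l..M. (\<kappa> a - \<kappa> x) * ?w a)"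
      by (intro sum.union_disjoint) auto
    also have "(\<Sum>a\<in>{1..<l}. (\<kappa> a - \<kappa> x) * ?w a) = - (\<Sum>a\<in>{1..<l}. (\<kappa> x - \<kappa> a) * ?w a)"
      by (simp add: sum_negf[symmetric] left_diff_distrib)
    also have "(\<Sum>a\<in>{1..<l}. (\<kappa> x - \<kappa> a) * ?w a) = (\<Sum>a\<in>{1..<l}. (\<kappa> x - \<kappa> a) * (\<pi> a + mcoef a * FL \<pi> a))"
      by (rule sum.cong[OF refl mass_left])
    also have "\<dots> = (\<Sum>a\<in>{1..<x}. (\<kappa> x - \<kappa> a) * (\<pi> a + mcoef a * FL \<pi> a))"
    proof (rule sum.mono_neutral_right)
      have "a = x" if "a \<in> {1..<l} - {1..<x}" for a using that x by auto
      then show "\<forall>a\<in>{1..<l} - {1..<x}. (\<kappa> x - \<kappa> a) * (\<pi> a + mcoef a * FL \<pi> a) = 0" by force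
    qed (use x in auto)
    also have "\<dots> = FL \<pi> x" by (rule FL_eq[symmetric])
    also have "(\<Sum>a=l..M. (\<kappa> a - \<kappa> x) * ?w a) = (\<Sum>a=l..M. (\<kappa> a - \<kappa> x) * (\<pi> a + mcoef a * FR \<pi> a))"
      by (rule sum.cong[OF refl mass_right])
    also have "\<dots> = (\<Sum>a=x + 1..M. (\<kappa> a - \<kappa> x) * (\<pi> a + mcoef a * FR \<pi> a))"
    proof (rule sum.mono_neutral_right)
      have "a = x" if "a \<in> {l..M} - {x + 1..M}" for a using that x by auto
      then show "\<forall>a\<in>{l..M} - {x + 1..M}. (\<kappa> a - \<kappa> x) * (\<pi> a + mcoef a * FR \<pi> a) = 0" by force
    qed (use x l2 in auto)
    also have "\<dots> = FR \<pi> x" using x l2 by (intro FR_eq[symmetric]) auto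
    finally show ?thesis by simp
  qed
  have W: "0 < (\<Sum>a=1..M. ?w a)" using wpos M by (intro sum_pos) auto
  have mean: "kappa_mean M \<kappa> kt s \<pi> (\<lambda>j. Y \<pi> j / s) = (\<Sum>a=1..M. \<kappa> a * ?w a) / (\<Sum>a=1..M. ?w a)"
    by (simp add: kappa_mean_def mult.assoc)
  have m1: "\<kappa> (l - 1) < kappa_mean M \<kappa> kt s \<pi> (\<lambda>j. Y \<pi> j / s)"
    unfolding mean pos_less_divide_eq[OF W] using moment[of "l - 1"] below[of "l - 1"] l2 by force
  have m2: "kappa_mean M \<kappa> kt s \<pi> (\<lambda>j. Y \<pi> j / s) \<le> \<kappa> l"
    unfolding mean pos_divide_le_eq[OF W] using moment[of l] l by force
  have eqs: "Y \<pi> j / s = 1 / (s * \<pi> j) *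
                 ((\<kappa> (j + 1) - \<kappa> (j - 1)) / ((\<kappa> (j + 1) - \<kappa> j) * (\<kappa> j - \<kappa> (j - 1)))) *
                 (if j \<le> l - 1
                  then (\<Sum>a=1..j - 1. (\<kappa> j - \<kappa> a) * \<pi> a * (1 + s * (Y \<pi> a / s) * kt a))
                  else (\<Sum>a=j + 1..M. (\<kappa> a - \<kappa> j) * \<pi> a * (1 + s * (Y \<pi> a / s) * kt a)))"
    if j: "j \<in> {2..M - 1}" for j
  proof -
    have "(if j \<le> l - 1 then (\<Sum>a=1..j - 1. (\<kappa> j - \<kappa> a) * ?w a) else (\<Sum>a=j + 1..M. (\<kappa> a - \<kappa> j) * ?w a))
        = min (FL \<pi> j) (FR \<pi> j)"
    proof (cases "j \<le> l - 1")
      case True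
      have "{1..j - 1} = {1..<j}" using j by auto
      then have "(\<Sum>a=1..j - 1. (\<kappa> j - \<kappa> a) * ?w a) = (\<Sum>a\<in>{1..<j}. (\<kappa> j - \<kappa> a) * (\<pi> a + mcoef a * FL \<pi> a))"
        using True by (intro sum.cong mass_left) auto
      then show ?thesis using True below[of j] j l2 FL_eq[of \<pi> j] by auto
    next
      case False
      then have "(\<Sum>a=j + 1..M. (\<kappa> a - \<kappa> j) * ?w a) = (\<Sum>a=j + 1..M. (\<kappa> a - \<kappa> j) * (\<pi> a + mcoef a * FR \<pi> a))"
        by (intro sum.cong mass_right) auto
      then show ?thesis using False above[of j] j l2 FR_eq[of j \<pi>] by auto
    qed
    then have B: "(if j \<le> l - 1
        then (\<Sum>a=1..j - 1. (\<kappa> j - \<kappa> a) * \<pi> a * (1 + s * (Y \<pi> a / s) * kt a))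
        else (\<Sum>a=j + 1..M. (\<kappa> a - \<kappa> j) * \<pi> a * (1 + s * (Y \<pi> a / s) * kt a))) = min (FL \<pi> j) (FR \<pi> j)"
      by (simp only: mult.assoc)
    show ?thesis unfolding B using j by (simp add: Y_def coef_def)
  qed
  have "Y \<pi> 1 = 0" "Y \<pi> M = 0" using M by (auto intro!: Y_outside)
  then show ?thesis
    unfolding G_system_def using Y_nonneg[OF \<pi>] s l2 m1 m2 eqs
    by (intro conjI bexI[of _ l]) auto
qed

section \<open>Mass balance for the linear system\<close>

context
  fixes y x u :: "nat \<Rightarrow> real"
  assumes y0: "\<And>c. c \<notin> {2..M - 1} \<Longrightarrow> y c = 0"
    and eq: "\<And>c. c \<in> {1..M} \<Longrightarrow>
      (1 + y c * (1 + kt c)) * x c - y (c - 1) * qu (c - 1) * x (c - 1) - y (c + 1) * qd (c + 1) * x (c + 1) = u c"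
begin

text \<open>Summing \<open>eq\<close> up to \<open>j\<close>, jumps inside the prefix cancel because
  the two jump probabilities add up to one. What remains is the killing and the two fluxes across
  the edge between \<open>j\<close> and \<open>j + 1\<close>.\<close>

lemma prefix_balance:
  "j \<le> M \<Longrightarrow> (\<Sum>c=1..j. u c) =
     (\<Sum>c=1..j. x c * (1 + y c * kt c)) + y j * qu j * x j - y (j + 1) * qd (j + 1) * x (j + 1)"
proof (induction j)
  case 0
  show ?case using y0[of 0] y0[of 1] by simp
next
  case (Suc j)
  have q: "y (Suc j) * qd (Suc j) + y (Suc j) * qu (Suc j) = y (Suc j)"
  proof (cases "Suc j \<in> {2..M - 1}")
    case True
    from q1[OF this] show ?thesis by (metis add.commute distrib_left mult.right_neutral)
  qed (use y0 in auto)
  have "y (Suc j) * qd (Suc j) * x (Suc j) + y (Suc j) * qu (Suc j) * x (Suc j) = y (Suc j) * x (Suc j)"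
    using q by (metis distrib_right)
  then show ?case
    using Suc eq[of "Suc j"] by (simp add: algebra_simps)
qed

lemma total_balance: "(\<Sum>c=1..M. u c) = (\<Sum>c=1..M. x c * (1 + y c * kt c))"
  using prefix_balance[of M] y0[of M] y0[of "M + 1"] M by simp

text \<open>Total balance minus the prefix balance up to \<open>j - 1\<close>.\<close>

lemma suffix_balance:
  assumes "j \<in> {1..M}"
  shows "(\<Sum>c=j..M. u c) =
     (\<Sum>c=j..M. x c * (1 + y c * kt c)) + y j * qd j * x j - y (j - 1) * qu (j - 1) * x (j - 1)"
proof -
  have split: "(\<Sum>c=1..M. f c) = (\<Sum>c=1..j - 1. f c) + (\<Sum>c=j..M. f c)" for f :: "nat \<Rightarrow> real"
  proof -
    have "{1..M} = {1..j - 1} \<union> {j..M}" using assms by auto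
    moreover have "{1..j - 1} \<inter> {j..M} = {}" using assms by auto
    ultimately show ?thesis by (metis finite_atLeastAtMost sum.union_disjoint)
  qed
  have "j - 1 + 1 = j" "j - 1 \<le> M" using assms by auto
  with prefix_balance[of "j - 1"] total_balance split[of u] split[of "\<lambda>c. x c * (1 + y c * kt c)"]
  show ?thesis by simp
qed

end

lemma tridiag_conditions:
  assumes "\<pi> \<in> prob_simplex M"
  shows "0 \<le> Y \<pi> c * qu c" "0 \<le> Y \<pi> c * qd c" "Y \<pi> 0 * qu 0 = 0" "Y \<pi> (Suc M) * qd (Suc M) = 0"
    and "1 + Y \<pi> c * qu c + Y \<pi> c * qd c \<le> 1 + Y \<pi> c * (1 + kt c)"
proof -
  show "0 \<le> Y \<pi> c * qu c" "0 \<le> Y \<pi> c * qd c"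
    using Y_nonneg[OF assms, of c] Y_outside[of c \<pi>] qu[of c] qd[of c] by (cases "c \<in> {2..M - 1}"; simp)+
  show "Y \<pi> 0 * qu 0 = 0" "Y \<pi> (Suc M) * qd (Suc M) = 0"
    using Y_outside[of 0 \<pi>] Y_outside[of "Suc M" \<pi>] M by auto
  show "1 + Y \<pi> c * qu c + Y \<pi> c * qd c \<le> 1 + Y \<pi> c * (1 + kt c)"
  proof (cases "c \<in> {2..M - 1}")
    case True
    have "Y \<pi> c * qu c + Y \<pi> c * qd c = Y \<pi> c * 1"
      using q1[OF True] by (metis distrib_left)
    moreover have "0 \<le> Y \<pi> c * kt c" using Y_nonneg[OF assms, of c] kt[of c] True by auto
    ultimately show ?thesis by (simp add: algebra_simps)
  qed (use Y_outside in auto)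
qed

section \<open>The mass distributions \<open>v\<close> and their flows\<close>

lemma v_pos: "\<pi> \<in> prob_simplex M \<Longrightarrow> j \<in> {1..M} \<Longrightarrow> 0 < v \<pi> n j"
proof (induction n arbitrary: j)
  case 0
  then show ?case
    using simplex_pos[of \<pi> j] kt[of j] Y_nonneg[of \<pi> j] by (auto intro!: divide_pos_pos add_pos_nonneg)
next
  case (Suc n)
  then show ?case
    by (simp only: v.simps, intro tridiag_solve_pos tridiag_conditions) auto
qed

lemma v_eq:
  assumes "\<pi> \<in> prob_simplex M" "c \<in> {1..M}"
  shows "(1 + Y \<pi> c * (1 + kt c)) * v \<pi> (Suc n) c - Y \<pi> (c - 1) * qu (c - 1) * v \<pi> (Suc n) (c - 1)
    - Y \<pi> (c + 1) * qd (c + 1) * v \<pi> (Suc n) (c + 1) = v \<pi> n c"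
  unfolding v.simps by (rule tridiag_solve_eq) (use assms tridiag_conditions in auto)

lemma v_0_le: "\<pi> \<in> prob_simplex M \<Longrightarrow> j \<in> {1..M} \<Longrightarrow> v \<pi> 0 j \<le> \<pi> j"
  using simplex_pos[of \<pi> j] kt[of j] Y_nonneg[of \<pi> j] by (auto simp: divide_le_eq mult_le_cancel_left1 add_pos_nonneg)

lemma v_weight_ge: "\<pi> \<in> prob_simplex M \<Longrightarrow> j \<in> {1..M} \<Longrightarrow> v \<pi> n j \<le> v \<pi> n j * (1 + Y \<pi> j * kt j)"
  using v_pos[of \<pi> j n] kt[of j] Y_nonneg[of \<pi> j] by (simp add: mult_le_cancel_left1)

text \<open>Jumps conserve the total and killing only lowers it, as does the division at stage
  0.\<close>

lemma v_sum_le: "\<pi> \<in> prob_simplex M \<Longrightarrow> (\<Sum>j=1..M. v \<pi> n j) \<le> 1"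
proof (induction n)
  case 0
  have "(\<Sum>j=1..M. v \<pi> 0 j) \<le> (\<Sum>j=1..M. \<pi> j)" by (intro sum_mono v_0_le 0)
  then show ?case using 0 by (simp add: prob_simplex_def)
next
  case (Suc n)
  have "(\<Sum>j=1..M. v \<pi> (Suc n) j) \<le> (\<Sum>j=1..M. v \<pi> (Suc n) j * (1 + Y \<pi> j * kt j))"
    by (intro sum_mono v_weight_ge Suc)
  also have "\<dots> = (\<Sum>j=1..M. v \<pi> n j)"
    by (rule total_balance[symmetric]) (use Suc v_eq Y_outside in auto)
  finally show ?case using Suc by simp
qed

lemma v_partial_sum_le: "\<pi> \<in> prob_simplex M \<Longrightarrow> A \<subseteq> {1..M} \<Longrightarrow> (\<Sum>j\<in>A. v \<pi> n j) \<le> 1"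
  by (rule order_trans[OF sum_mono2 v_sum_le]) (auto intro!: less_imp_le v_pos)

lemma v_le_1: "\<pi> \<in> prob_simplex M \<Longrightarrow> j \<in> {1..M} \<Longrightarrow> v \<pi> n j \<le> 1"
  using v_partial_sum_le[of \<pi> "{j}" n] by simp

text \<open>Prefix balance with killing dropped and \<open>qd\<close> bounded by one. The upward
  flux out of \<open>j\<close> is kept on the left because \<open>v_jump_rate_bound\<close> rests on
  it.\<close>

lemma flow_left:
  assumes "\<pi> \<in> prob_simplex M" "1 \<le> j" "j < M"
  shows "(\<Sum>c=1..j. v \<pi> (Suc n) c) + Y \<pi> j * qu j * v \<pi> (Suc n) j
    \<le> (\<Sum>c=1..j. v \<pi> n c) + Y \<pi> (Suc j) * v \<pi> (Suc n) (Suc j)"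
proof -
  let ?x = "v \<pi> (Suc n)"
  have "(\<Sum>c=1..j. v \<pi> n c) = (\<Sum>c=1..j. ?x c * (1 + Y \<pi> c * kt c)) + Y \<pi> j * qu j * ?x j
      - Y \<pi> (j + 1) * qd (j + 1) * ?x (j + 1)"
    by (rule prefix_balance) (use v_eq Y_outside assms in auto)
  moreover have "(\<Sum>c=1..j. ?x c) \<le> (\<Sum>c=1..j. ?x c * (1 + Y \<pi> c * kt c))"
    using assms by (intro sum_mono v_weight_ge) auto
  moreover have "Y \<pi> (Suc j) * qd (Suc j) * ?x (Suc j) \<le> Y \<pi> (Suc j) * ?x (Suc j)"
  proof (cases "Suc j \<in> {2..M - 1}")
    case True
    then have "Y \<pi> (Suc j) * qd (Suc j) \<le> Y \<pi> (Suc j) * 1"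
      using qu[OF True] q1[OF True] Y_nonneg[OF assms(1)] by (intro mult_left_mono) auto
    then show ?thesis using v_pos[OF assms(1), of "Suc j" "Suc n"] assms by (intro mult_right_mono) auto
  qed (use Y_outside in auto)
  ultimately show ?thesis by simp
qed

lemma flow_right:
  assumes "\<pi> \<in> prob_simplex M" "1 < j" "j \<le> M"
  shows "(\<Sum>c=j..M. v \<pi> (Suc n) c) \<le> (\<Sum>c=j..M. v \<pi> n c) + Y \<pi> (j - 1) * v \<pi> (Suc n) (j - 1)"
proof -
  let ?x = "v \<pi> (Suc n)"
  have "(\<Sum>c=j..M. v \<pi> n c) = (\<Sum>c=j..M. ?x c * (1 + Y \<pi> c * kt c)) + Y \<pi> j * qd j * ?x j
      - Y \<pi> (j - 1) * qu (j - 1) * ?x (j - 1)"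
    by (rule suffix_balance) (use v_eq Y_outside assms in auto)
  moreover have "(\<Sum>c=j..M. ?x c) \<le> (\<Sum>c=j..M. ?x c * (1 + Y \<pi> c * kt c))"
    using assms by (intro sum_mono v_weight_ge) auto
  moreover have "0 \<le> Y \<pi> j * qd j * ?x j"
    using tridiag_conditions(2)[OF assms(1), of j] v_pos[OF assms(1), of j "Suc n"] assms by auto
  moreover have "Y \<pi> (j - 1) * qu (j - 1) * ?x (j - 1) \<le> Y \<pi> (j - 1) * ?x (j - 1)"
  proof (cases "j - 1 \<in> {2..M - 1}")
    case True
    then have "Y \<pi> (j - 1) * qu (j - 1) \<le> Y \<pi> (j - 1) * 1"
      using qd[OF True] q1[OF True] Y_nonneg[OF assms(1)] by (intro mult_left_mono) auto
    moreover have "0 < ?x (j - 1)" by (rule v_pos) (use assms in auto)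
    ultimately show ?thesis by (metis mult.right_neutral mult_right_mono less_imp_le)
  qed (use Y_outside in auto)
  ultimately show ?thesis by simp
qed

section \<open>Bounds uniform over the open simplex\<close>

lemma sum_reflect:
  "j \<in> {1..M} \<Longrightarrow> (\<Sum>c=1..j. f (M + 1 - c)) = (\<Sum>c=M + 1 - j..M. f c)" for f :: "nat \<Rightarrow> real"
  by (rule sum.reindex_bij_witness[where i = "\<lambda>a. M + 1 - a" and j = "\<lambda>a. M + 1 - a"]) auto

lemma uniform_constant:
  obtains K where "1 \<le> K" "\<And>j. coef j \<le> K" "\<And>j. j \<in> {2..M - 1} \<Longrightarrow> 1 \<le> K * coef j"
    "\<And>j. j \<in> {2..M - 1} \<Longrightarrow> 1 \<le> K * qu j" "\<And>j. j \<in> {1..M} \<Longrightarrow> kt j \<le> K"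
proof -
  \<comment> \<open>The reciprocals turn an upper bound on \<open>g\<close> into lower bounds on
    \<open>coef\<close> and \<open>qu\<close>.\<close>
  define g where "g j = coef j + 1 / coef j + 1 / qu j" for j
  define K where "K = 1 + (\<Sum>j\<in>{2..M - 1}. g j) + (\<Sum>j\<in>{1..M}. kt j)"
  have s0: "0 \<le> 1 / coef j" "0 \<le> 1 / qu j" "0 \<le> g j" if "j \<in> {2..M - 1}" for j
    using that coef_pos[of j] qu[of j] by (auto simp: g_def)
  have S: "0 \<le> (\<Sum>j\<in>{2..M - 1}. g j)" "0 \<le> (\<Sum>j\<in>{1..M}. kt j)"
    using s0 kt by (auto intro!: sum_nonneg)
  have g: "g j \<le> K" if "j \<in> {2..M - 1}" for j
    using member_le_sum[of j "{2..M - 1}" g] that s0 S by (auto simp: K_def)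
  have k: "kt j \<le> K" if "j \<in> {1..M}" for j
    using member_le_sum[of j "{1..M}" kt] that kt S by (auto simp: K_def)
  show thesis
  proof (rule that)
    show "1 \<le> K" using S by (simp add: K_def)
    then show "coef j \<le> K" for j
      using g[of j] s0(1,2)[of j] coef_outside[of j] unfolding g_def by (cases "j \<in> {2..M - 1}") linarith+
    show "1 \<le> K * coef j" if "j \<in> {2..M - 1}" for j
    proof -
      have "1 / coef j \<le> K" using g[OF that] s0[OF that] coef_pos[OF that] unfolding g_def by linarith
      then show ?thesis using coef_pos[OF that] by (simp add: pos_divide_le_eq)
    qed
    show "1 \<le> K * qu j" if "j \<in> {2..M - 1}" for j
    proof -
      have "1 / qu j \<le> K" using g[OF that] s0[OF that] coef_pos[OF that] unfolding g_def by linarith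
      then show ?thesis using qu[OF that] by (simp add: pos_divide_le_eq)
    qed
    show "kt j \<le> K" if "j \<in> {1..M}" for j by (rule k[OF that])
  qed
qed

text \<open>One constant for all \<pi> and for both sides, the right one by reflection. The bound on
  the minimum is the converse of the barrier inequality \<open>Y j * \<pi> j \<le> C * F j\<close>:
  if \<open>Y \<pi> j * \<pi> j\<close> is small, so is one of the two moments.\<close>

lemma uniform_bounds:
  obtains C where "1 \<le> C"
    and "\<And>\<pi>. \<pi> \<in> prob_simplex M \<Longrightarrow> leaky_chain M C \<pi> (Y \<pi>) (FL \<pi>) (v \<pi>)"
    and "\<And>\<pi>. \<pi> \<in> prob_simplex M \<Longrightarrow> leaky_chain M C (\<lambda>j. \<pi> (M + 1 - j)) (\<lambda>j. Y \<pi> (M + 1 - j))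
      (\<lambda>j. FR \<pi> (M + 1 - j)) (\<lambda>n j. v \<pi> n (M + 1 - j))"
    and "\<And>\<pi> j. \<pi> \<in> prob_simplex M \<Longrightarrow> j \<in> {1..M} \<Longrightarrow> min (FL \<pi> j) (FR \<pi> j) \<le> C * (Y \<pi> j * \<pi> j)"
    and "\<And>j. j \<in> {1..M} \<Longrightarrow> kt j \<le> C"
proof -
  obtain K where K: "1 \<le> K" "\<And>j. coef j \<le> K" "\<And>j. j \<in> {2..M - 1} \<Longrightarrow> 1 \<le> K * coef j"
    "\<And>j. j \<in> {2..M - 1} \<Longrightarrow> 1 \<le> K * qu j" "\<And>j. j \<in> {1..M} \<Longrightarrow> kt j \<le> K"
    using uniform_constant by blast
  obtain A where A: "1 \<le> A"
    "\<And>\<pi> j. (\<And>a. a \<in> {1..M} \<Longrightarrow> 0 < \<pi> a) \<Longrightarrow> 1 \<le> j \<Longrightarrow> j < M \<Longrightarrow>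
      left_moment \<kappa> mcoef \<pi> (Suc j) \<le> A * (left_moment \<kappa> mcoef \<pi> j + \<pi> j)"
    "\<And>\<pi> j. (\<And>a. a \<in> {1..M} \<Longrightarrow> 0 < \<pi> a) \<Longrightarrow> 1 \<le> j \<Longrightarrow> j \<le> M \<Longrightarrow>
      (\<Sum>a\<in>{1..<j}. \<pi> a) \<le> A * left_moment \<kappa> mcoef \<pi> j"
    using left_moment_bounds[of M \<kappa> mcoef, OF \<kappa> mcoef_nonneg] by blast
  let ?\<kappa>' = "\<lambda>a. - \<kappa> (M + 1 - a)" and ?m' = "\<lambda>a. mcoef (M + 1 - a)"
  obtain B where B: "1 \<le> B"
    "\<And>\<pi> j. (\<And>a. a \<in> {1..M} \<Longrightarrow> 0 < \<pi> a) \<Longrightarrow> 1 \<le> j \<Longrightarrow> j < M \<Longrightarrow>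
      left_moment ?\<kappa>' ?m' \<pi> (Suc j) \<le> B * (left_moment ?\<kappa>' ?m' \<pi> j + \<pi> j)"
    "\<And>\<pi> j. (\<And>a. a \<in> {1..M} \<Longrightarrow> 0 < \<pi> a) \<Longrightarrow> 1 \<le> j \<Longrightarrow> j \<le> M \<Longrightarrow>
      (\<Sum>a\<in>{1..<j}. \<pi> a) \<le> B * left_moment ?\<kappa>' ?m' \<pi> j"
    using left_moment_bounds[of M ?\<kappa>' ?m', OF mono_reflected mcoef_reflected_nonneg] by blast
  define C where "C = A + B + K"
  have C: "1 \<le> C" "A \<le> C" "B \<le> C" "K \<le> C" using A(1) B(1) K(1) by (auto simp: C_def)
  show thesis
  proof (rule that[of C])
    show "1 \<le> C" by fact
  next
    fix \<pi> assume \<pi>: "\<pi> \<in> prob_simplex M"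
    have YF: "Y \<pi> j * \<pi> j \<le> C * FL \<pi> j" "Y \<pi> j * \<pi> j \<le> C * FR \<pi> j" if "j \<in> {1..M}" for j
    proof -
      have "coef j * min (FL \<pi> j) (FR \<pi> j) \<le> C * min (FL \<pi> j) (FR \<pi> j)"
        using K(2)[of j] C that FL_nonneg[OF \<pi>, of j] FR_nonneg[OF \<pi>, of j] by (intro mult_right_mono) auto
      moreover have "C * min (FL \<pi> j) (FR \<pi> j) \<le> C * FL \<pi> j" "C * min (FL \<pi> j) (FR \<pi> j) \<le> C * FR \<pi> j"
        using C by (auto intro!: mult_left_mono)
      ultimately show "Y \<pi> j * \<pi> j \<le> C * FL \<pi> j" "Y \<pi> j * \<pi> j \<le> C * FR \<pi> j"
        unfolding Y_times[OF \<pi> that] by auto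
    qed
    show "leaky_chain M C \<pi> (Y \<pi>) (FL \<pi>) (v \<pi>)"
      unfolding leaky_chain_def
    proof (intro conjI ballI allI impI)
      fix j assume j: "j \<in> {1..M}"
      show "0 < \<pi> j" "0 \<le> Y \<pi> j" "v \<pi> 0 j \<le> \<pi> j" "Y \<pi> j * \<pi> j \<le> C * FL \<pi> j"
        by (rule simplex_pos Y_nonneg v_0_le YF \<pi> j)+
      show F: "0 \<le> FL \<pi> j" using FL_nonneg[OF \<pi>] j by auto
      have "(\<Sum>a\<in>{1..<j}. \<pi> a) \<le> A * FL \<pi> j"
        unfolding FL_def by (rule A(3)) (use j simplex_pos[OF \<pi>] in auto)
      also have "\<dots> \<le> C * FL \<pi> j" using C F by (intro mult_right_mono) auto
      finally show "(\<Sum>a\<in>{1..<j}. \<pi> a) \<le> C * FL \<pi> j" .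
      show "0 \<le> v \<pi> n j" "v \<pi> n j \<le> 1" for n
        using v_pos[OF \<pi> j, of n] v_le_1[OF \<pi> j, of n] by auto
    next
      show "(\<Sum>j=1..M. \<pi> j) = 1" using \<pi> by (simp add: prob_simplex_def)
    next
      fix j assume j: "1 \<le> j" "j < M"
      have "FL \<pi> (Suc j) \<le> A * (FL \<pi> j + \<pi> j)"
        unfolding FL_def by (rule A(2)) (use j simplex_pos[OF \<pi>] in auto)
      also have "\<dots> \<le> C * (FL \<pi> j + \<pi> j)"
        using C FL_nonneg[OF \<pi>, of j] simplex_pos[OF \<pi>, of j] j by (intro mult_right_mono) auto
      finally show "FL \<pi> (Suc j) \<le> C * (FL \<pi> j + \<pi> j)" .
      show "(\<Sum>c=1..j. v \<pi> (Suc n) c) \<le> (\<Sum>c=1..j. v \<pi> n c) + Y \<pi> (Suc j) * v \<pi> (Suc n) (Suc j)" for n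
      proof -
        have "0 \<le> Y \<pi> j * qu j * v \<pi> (Suc n) j"
          using tridiag_conditions(1)[OF \<pi>, of j] v_pos[OF \<pi>, of j "Suc n"] j
          by (intro mult_nonneg_nonneg[of "_ * _"]) (auto intro: less_imp_le)
        with flow_left[OF \<pi> j, of n] show ?thesis by simp
      qed
    qed
    show "leaky_chain M C (\<lambda>j. \<pi> (M + 1 - j)) (\<lambda>j. Y \<pi> (M + 1 - j))
      (\<lambda>j. FR \<pi> (M + 1 - j)) (\<lambda>n j. v \<pi> n (M + 1 - j))"
      unfolding leaky_chain_def
    proof (intro conjI ballI allI impI)
      fix j assume j: "j \<in> {1..M}"
      then have j': "M + 1 - j \<in> {1..M}" "M + 1 - (M + 1 - j) = j" by auto
      show "0 < \<pi> (M + 1 - j)" "0 \<le> Y \<pi> (M + 1 - j)" "v \<pi> 0 (M + 1 - j) \<le> \<pi> (M + 1 - j)"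
        "Y \<pi> (M + 1 - j) * \<pi> (M + 1 - j) \<le> C * FR \<pi> (M + 1 - j)"
        by (rule simplex_pos Y_nonneg v_0_le YF \<pi> j')+
      show F: "0 \<le> FR \<pi> (M + 1 - j)" using FR_nonneg[OF \<pi>] j' by auto
      have "(\<Sum>a\<in>{1..<j}. \<pi> (M + 1 - a)) \<le> B * FR \<pi> (M + 1 - j)"
        unfolding FR_def j' by (rule B(3)) (use j simplex_reflected_pos[OF \<pi>] in auto)
      also have "\<dots> \<le> C * FR \<pi> (M + 1 - j)" using C F by (intro mult_right_mono) auto
      finally show "(\<Sum>a\<in>{1..<j}. \<pi> (M + 1 - a)) \<le> C * FR \<pi> (M + 1 - j)" .
      show "0 \<le> v \<pi> n (M + 1 - j)" "v \<pi> n (M + 1 - j) \<le> 1" for n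
        using v_pos[OF \<pi> j'(1), of n] v_le_1[OF \<pi> j'(1), of n] by auto
    next
      have "(\<Sum>j=1..M. \<pi> (M + 1 - j)) = (\<Sum>j=1..M. \<pi> j)"
        using sum_reflect[of M \<pi>] M by simp
      then show "(\<Sum>j=1..M. \<pi> (M + 1 - j)) = 1" using \<pi> by (simp add: prob_simplex_def)
    next
      fix j assume j: "1 \<le> j" "j < M"
      then have j': "M + 1 - (M + 1 - j) = j" "M + 1 - (M + 1 - Suc j) = Suc j" by auto
      have "FR \<pi> (M + 1 - Suc j) \<le> B * (FR \<pi> (M + 1 - j) + \<pi> (M + 1 - j))"
        unfolding FR_def j' by (rule B(2)) (use j simplex_reflected_pos[OF \<pi>] in auto)
      also have "\<dots> \<le> C * (FR \<pi> (M + 1 - j) + \<pi> (M + 1 - j))"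
        using C FR_nonneg[OF \<pi>, of "M + 1 - j"] simplex_reflected_pos[OF \<pi>, of j] j
        by (intro mult_right_mono) auto
      finally show "FR \<pi> (M + 1 - Suc j) \<le> C * (FR \<pi> (M + 1 - j) + \<pi> (M + 1 - j))" .
      show "(\<Sum>c=1..j. v \<pi> (Suc n) (M + 1 - c)) \<le> (\<Sum>c=1..j. v \<pi> n (M + 1 - c))
          + Y \<pi> (M + 1 - Suc j) * v \<pi> (Suc n) (M + 1 - Suc j)" for n
      proof -
        have "j \<in> {1..M}" "1 < M + 1 - j" "M + 1 - j \<le> M" "M + 1 - j - 1 = M + 1 - Suc j"
          using j by auto
        with flow_right[OF \<pi>, of "M + 1 - j" n] show ?thesis
          unfolding sum_reflect[OF \<open>j \<in> {1..M}\<close>] by metis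
      qed
    qed
    show "min (FL \<pi> j) (FR \<pi> j) \<le> C * (Y \<pi> j * \<pi> j)" if j: "j \<in> {1..M}" for j
    proof (cases "j \<in> {2..M - 1}")
      case True
      let ?m = "min (FL \<pi> j) (FR \<pi> j)"
      have m: "0 \<le> ?m" using FL_nonneg[OF \<pi>, of j] FR_nonneg[OF \<pi>, of j] j by auto
      have "1 * ?m \<le> (K * coef j) * ?m" using K(3)[OF True] m by (intro mult_right_mono) auto
      also have "\<dots> \<le> (C * coef j) * ?m" using C m coef_nonneg by (intro mult_right_mono) auto
      finally show ?thesis unfolding Y_times[OF \<pi> j] by (simp add: mult.assoc)
    next
      \<comment> \<open>At an end site one of the two moments vanishes.\<close>
      case False
      then have "j = 1 \<or> j = M" using j by auto
      then show ?thesis using FL_nonneg[OF \<pi>, of M] FR_nonneg[OF \<pi>, of 1] Y_outside[OF False] by auto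
    qed
  next
    show "kt j \<le> C" if "j \<in> {1..M}" for j using K(5)[OF that] C by simp
  qed
qed

text \<open>\<open>Y \<pi> j\<close> may blow up as \<open>\<pi> j\<close> tends to 0, but the flux
  out of \<open>j\<close> does not: what leaves \<open>1..j\<close> upwards was there before, with
  mass at most one, or enters from \<open>j + 1\<close>. Going down from \<open>M\<close>, where the
  flux is zero, each site costs a factor \<open>2 * K\<close>, with \<open>K\<close> accounting for
  \<open>qu\<close>.\<close>

lemma v_jump_rate_bound:
  obtains Z where "0 < Z"
    and "\<And>\<pi> j n. \<pi> \<in> prob_simplex M \<Longrightarrow> j \<in> {1..M} \<Longrightarrow> Y \<pi> j * v \<pi> (Suc n) j \<le> Z"
proof -
  obtain K where K: "1 \<le> K" "\<And>j. j \<in> {2..M - 1} \<Longrightarrow> 1 \<le> K * qu j"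
    using uniform_constant by metis
  have bound: "Y \<pi> j * v \<pi> (Suc n) j \<le> (2 * K) ^ (M - j)"
    if \<pi>: "\<pi> \<in> prob_simplex M" and j: "1 \<le> j" "j \<le> M" for \<pi> j n
    using j(2,1)
  proof (induction j rule: inc_induct)
    case base
    show ?case using Y_outside[of M \<pi>] M by simp
  next
    case (step j)
    let ?x = "v \<pi> (Suc n)"
    have P: "1 \<le> (2 * K) ^ (M - Suc j)" using K by (intro one_le_power) auto
    show ?case
    proof (cases "j \<in> {2..M - 1}")
      case True
      have x0: "0 < ?x c" if "c \<in> {1..M}" for c using v_pos[OF \<pi> that] .
      have "Y \<pi> j * ?x j * 1 \<le> Y \<pi> j * ?x j * (K * qu j)"
        using K(2)[OF True] Y_nonneg[OF \<pi>, of j] x0[of j] step by (intro mult_left_mono mult_nonneg_nonneg) auto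
      also have "\<dots> = K * (Y \<pi> j * qu j * ?x j)" by simp
      also have "Y \<pi> j * qu j * ?x j \<le> (\<Sum>c=1..j. v \<pi> n c) + Y \<pi> (Suc j) * ?x (Suc j)"
      proof -
        have "0 \<le> (\<Sum>c=1..j. ?x c)" using x0 step by (intro sum_nonneg less_imp_le) auto
        with flow_left[OF \<pi>, of j n] step show ?thesis by simp
      qed
      also have "(\<Sum>c=1..j. v \<pi> n c) \<le> 1" using step by (intro v_partial_sum_le \<pi>) auto
      also have "Y \<pi> (Suc j) * ?x (Suc j) \<le> (2 * K) ^ (M - Suc j)" using step by simp
      also have "1 + (2 * K) ^ (M - Suc j) \<le> 2 * (2 * K) ^ (M - Suc j)" using P by linarith
      also have "K * (2 * (2 * K) ^ (M - Suc j)) = (2 * K) ^ Suc (M - Suc j)" by simp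
      also have "Suc (M - Suc j) = M - j" using step by simp
      finally show ?thesis using K by simp
    next
      case False
      then show ?thesis using Y_outside[OF False] K by simp
    qed
  qed
  show thesis
  proof (rule that[of "(2 * K) ^ M"])
    show "0 < (2 * K) ^ M" using K by simp
    fix \<pi> j n assume *: "\<pi> \<in> prob_simplex M" "j \<in> {1..M}"
    have "Y \<pi> j * v \<pi> (Suc n) j \<le> (2 * K) ^ (M - j)" using bound[of \<pi> j n] * by auto
    also have "\<dots> \<le> (2 * K) ^ M" using K by (intro power_increasing) auto
    finally show "Y \<pi> j * v \<pi> (Suc n) j \<le> (2 * K) ^ M" .
  qed
qed

lemma v_coordinate_small:
  assumes \<eta>: "0 < \<eta>"
  obtains \<delta> where "0 < \<delta>"
    and "\<And>\<pi> j. \<pi> \<in> prob_simplex M \<Longrightarrow> j \<in> {1..M} \<Longrightarrow> \<pi> j \<le> \<delta> \<Longrightarrow> v \<pi> R j \<le> \<eta>"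
proof -
  obtain C where C: "1 \<le> C"
    and L: "\<And>\<pi>. \<pi> \<in> prob_simplex M \<Longrightarrow> leaky_chain M C \<pi> (Y \<pi>) (FL \<pi>) (v \<pi>)"
    and R: "\<And>\<pi>. \<pi> \<in> prob_simplex M \<Longrightarrow> leaky_chain M C (\<lambda>j. \<pi> (M + 1 - j)) (\<lambda>j. Y \<pi> (M + 1 - j))
      (\<lambda>j. FR \<pi> (M + 1 - j)) (\<lambda>n j. v \<pi> n (M + 1 - j))"
    and mn: "\<And>\<pi> j. \<pi> \<in> prob_simplex M \<Longrightarrow> j \<in> {1..M} \<Longrightarrow> min (FL \<pi> j) (FR \<pi> j) \<le> C * (Y \<pi> j * \<pi> j)"
    using uniform_bounds by metis
  obtain Z where Z: "0 < Z"
    "\<And>\<pi> j n. \<pi> \<in> prob_simplex M \<Longrightarrow> j \<in> {1..M} \<Longrightarrow> Y \<pi> j * v \<pi> (Suc n) j \<le> Z"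
    using v_jump_rate_bound by metis
  obtain \<epsilon> where \<epsilon>: "0 < \<epsilon>"
    and small: "\<And>\<pi> Y F v j n. leaky_chain M C \<pi> Y F v \<Longrightarrow> j \<in> {1..M} \<Longrightarrow> F j \<le> \<epsilon> \<Longrightarrow> \<pi> j \<le> \<epsilon> \<Longrightarrow>
      n \<le> R \<Longrightarrow> (\<Sum>c=1..j. v n c) \<le> \<eta>"
    using leaky_chain_mass_small[OF C \<eta>, of M R] M by auto
  \<comment> \<open>Cutoff on \<open>Y \<pi> j\<close>: above it the flux bound \<open>Z\<close>
    alone forces mass at most \<eta>; below it \<open>min (FL \<pi> j) (FR \<pi> j)\<close> is at
    most \<open>C * (\<Lambda> * \<delta>)\<close>.\<close>
  define \<Lambda> where "\<Lambda> = Z / \<eta>"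
  have \<Lambda>: "0 < \<Lambda>" using Z \<eta> by (simp add: \<Lambda>_def)
  \<comment> \<open>The first bound serves R = 0, where no system has been solved and the flux bound
    does not apply; the other two meet the two smallness hypotheses of \<open>small\<close>.\<close>
  define \<delta> where "\<delta> = min \<eta> (min \<epsilon> (\<epsilon> / (C * \<Lambda>)))"
  have \<delta>: "0 < \<delta>" "\<delta> \<le> \<eta>" "\<delta> \<le> \<epsilon>" "C * (\<Lambda> * \<delta>) \<le> \<epsilon>"
  proof -
    have "C * \<Lambda> * \<delta> \<le> C * \<Lambda> * (\<epsilon> / (C * \<Lambda>))"
      using C \<Lambda> by (intro mult_left_mono) (auto simp: \<delta>_def)
    then show "C * (\<Lambda> * \<delta>) \<le> \<epsilon>" using C \<Lambda> by simp
  qed (use \<eta> \<epsilon> C \<Lambda> in \<open>auto simp: \<delta>_def\<close>)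
  show thesis
  proof (rule that[OF \<delta>(1)])
    fix \<pi> j assume \<pi>: "\<pi> \<in> prob_simplex M" and j: "j \<in> {1..M}" and d: "\<pi> j \<le> \<delta>"
    have v0: "0 \<le> v \<pi> R c" if "c \<in> {1..M}" for c using v_pos[OF \<pi> that, of R] by simp
    show "v \<pi> R j \<le> \<eta>"
    proof (cases "Y \<pi> j \<le> \<Lambda>")
      case True
      have "min (FL \<pi> j) (FR \<pi> j) \<le> C * (Y \<pi> j * \<pi> j)" by (rule mn[OF \<pi> j])
      also have "\<dots> \<le> C * (\<Lambda> * \<delta>)"
        using True d C Y_nonneg[OF \<pi>, of j] simplex_pos[OF \<pi> j] \<Lambda> by (intro mult_left_mono mult_mono) auto
      also have "\<dots> \<le> \<epsilon>" by fact
      finally consider "FL \<pi> j \<le> \<epsilon>" | "FR \<pi> j \<le> \<epsilon>" by linarith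
      then show ?thesis
      proof cases
        case 1
        have "v \<pi> R j \<le> (\<Sum>c=1..j. v \<pi> R c)"
          using j v0 by (intro member_le_sum) auto
        also have "\<dots> \<le> \<eta>" using small[OF L[OF \<pi>] j 1] d \<delta> by simp
        finally show ?thesis .
      next
        case 2
        define j' where "j' = M + 1 - j"
        have j': "j' \<in> {1..M}" "M + 1 - j' = j" using j by (auto simp: j'_def)
        have "v \<pi> R j \<le> (\<Sum>c=j..M. v \<pi> R c)"
          using j v0 by (intro member_le_sum) auto
        also have "\<dots> = (\<Sum>c=1..j'. v \<pi> R (M + 1 - c))"
          using sum_reflect[OF j'(1), of "v \<pi> R"] j' by simp
        also have "\<dots> \<le> \<eta>"
          using small[OF R[OF \<pi>] j'(1), of R] 2 d \<delta> j'(2) by simp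
        finally show ?thesis .
      qed
    next
      case False
      show ?thesis
      proof (cases R)
        case 0
        then show ?thesis using v_0_le[OF \<pi> j] d \<delta> by simp
      next
        case (Suc n)
        have "\<Lambda> * v \<pi> R j \<le> Y \<pi> j * v \<pi> R j" using False v0[OF j] by (intro mult_right_mono) auto
        also have "\<dots> \<le> Z" unfolding Suc by (rule Z(2)[OF \<pi> j])
        finally show ?thesis using Z \<eta> by (simp add: \<Lambda>_def field_simps)
      qed
    qed
  qed
qed

text \<open>Some site carries mass at least 1 / M, and its intensity is bounded because the moments
  are. Dropping the inflow from its equation, each solve leaves at least the fraction 1 / H of the
  mass there, where \<open>H\<close> bounds the diagonal entry.\<close>

lemma v_total_lower_bound:
  obtains c where "0 < c" and "\<And>\<pi>. \<pi> \<in> prob_simplex M \<Longrightarrow> c \<le> (\<Sum>j=1..M. v \<pi> R j)"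
proof -
  obtain C where C: "1 \<le> C"
    and L: "\<And>\<pi>. \<pi> \<in> prob_simplex M \<Longrightarrow> leaky_chain M C \<pi> (Y \<pi>) (FL \<pi>) (v \<pi>)"
    and ktC: "\<And>j. j \<in> {1..M} \<Longrightarrow> kt j \<le> C"
    using uniform_bounds by metis
  define H where "H = 1 + C * (2 * C) ^ M * real M * (1 + C)"
  have H: "1 \<le> H" using C by (simp add: H_def)
  show thesis
  proof (rule that[of "1 / real M / H ^ Suc R"])
    show "0 < 1 / real M / H ^ Suc R" using H M by simp
    fix \<pi> assume \<pi>: "\<pi> \<in> prob_simplex M"
    have F: "FL \<pi> j \<le> (2 * C) ^ j" if "1 \<le> j" "j \<le> M" for j
      using that
    proof (induction j rule: dec_induct)
      case base
      show ?case using C by simp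
    next
      case (step j)
      have "\<pi> j \<le> 1" using \<pi> step by (simp add: prob_simplex_def less_imp_le)
      also have "1 \<le> (2 * C) ^ j" using C by (intro one_le_power) auto
      finally have 1: "\<pi> j \<le> (2 * C) ^ j" .
      have "FL \<pi> (Suc j) \<le> C * (FL \<pi> j + \<pi> j)" using L[OF \<pi>] step by (auto simp: leaky_chain_def)
      also have "\<dots> \<le> C * ((2 * C) ^ j + (2 * C) ^ j)"
        using step 1 C by (intro mult_left_mono add_mono) auto
      finally show ?case by (simp add: algebra_simps)
    qed
    have "\<exists>j\<in>{1..M}. 1 / real M \<le> \<pi> j"
    proof (rule ccontr)
      assume "\<not> ?thesis"
      then have "(\<Sum>j=1..M. \<pi> j) < (\<Sum>j=1..M. 1 / real M)"
        using M by (intro sum_strict_mono) (auto simp: not_le)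
      then show False using \<pi> M by (simp add: prob_simplex_def)
    qed
    then obtain j where j: "j \<in> {1..M}" "1 / real M \<le> \<pi> j" by blast
    have Y0: "0 \<le> Y \<pi> j" by (rule Y_nonneg[OF \<pi>])
    have "Y \<pi> j * (1 / real M) \<le> Y \<pi> j * \<pi> j" using j Y0 by (intro mult_left_mono) auto
    also have "\<dots> \<le> C * FL \<pi> j" using L[OF \<pi>] j by (auto simp: leaky_chain_def)
    also have "\<dots> \<le> C * (2 * C) ^ M"
    proof (intro mult_left_mono)
      have "FL \<pi> j \<le> (2 * C) ^ j" using F j by auto
      also have "\<dots> \<le> (2 * C) ^ M" using C j by (intro power_increasing) auto
      finally show "FL \<pi> j \<le> (2 * C) ^ M" .
    qed (use C in auto)
    finally have Y: "Y \<pi> j \<le> C * (2 * C) ^ M * real M" using M by (simp add: pos_divide_le_eq)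
    have "Y \<pi> j * (1 + kt j) \<le> C * (2 * C) ^ M * real M * (1 + C)"
      using Y Y0 ktC[OF j(1)] kt[OF j(1)] C by (intro mult_mono) auto
    then have dH: "1 + Y \<pi> j * (1 + kt j) \<le> H" by (simp add: H_def)
    have "1 / real M / H ^ Suc n \<le> v \<pi> n j" for n
    proof (induction n)
      case 0
      have "kt j * Y \<pi> j \<le> Y \<pi> j * (1 + kt j)" using Y0 by (simp add: algebra_simps)
      then have "1 + kt j * Y \<pi> j \<le> H" using dH by simp
      moreover have "0 < 1 + kt j * Y \<pi> j" using kt[OF j(1)] Y0 by (intro add_pos_nonneg) auto
      ultimately have "1 / real M / H \<le> \<pi> j / (1 + kt j * Y \<pi> j)"
        using j simplex_pos[OF \<pi> j(1)] by (intro frac_le) auto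
      then show ?case by simp
    next
      case (Suc n)
      let ?x = "v \<pi> (Suc n)"
      have x: "0 < ?x j" by (rule v_pos[OF \<pi> j(1)])
      have nn: "0 \<le> Y \<pi> (j - 1) * qu (j - 1) * ?x (j - 1)" "0 \<le> Y \<pi> (j + 1) * qd (j + 1) * ?x (j + 1)"
      proof -
        show "0 \<le> Y \<pi> (j - 1) * qu (j - 1) * ?x (j - 1)"
        proof (cases "j - 1 \<in> {2..M - 1}")
          case True
          have "0 < ?x (j - 1)" by (rule v_pos[OF \<pi>]) (use True in auto)
          then show ?thesis
            using mult_nonneg_nonneg[OF tridiag_conditions(1)[OF \<pi>, of "j - 1"], of "?x (j - 1)"] by linarith
        qed (simp add: Y_outside)
        show "0 \<le> Y \<pi> (j + 1) * qd (j + 1) * ?x (j + 1)"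
        proof (cases "j + 1 \<in> {2..M - 1}")
          case True
          have "0 < ?x (j + 1)" by (rule v_pos[OF \<pi>]) (use True in auto)
          then show ?thesis
            using mult_nonneg_nonneg[OF tridiag_conditions(2)[OF \<pi>, of "j + 1"], of "?x (j + 1)"] by linarith
        qed (simp add: Y_outside)
      qed
      have "v \<pi> n j \<le> (1 + Y \<pi> j * (1 + kt j)) * ?x j"
        using v_eq[OF \<pi> j(1), of n] nn by linarith
      also have "\<dots> \<le> H * ?x j" using dH x by (intro mult_right_mono) auto
      finally have "v \<pi> n j \<le> H * ?x j" .
      then have "1 / real M / H ^ Suc n \<le> ?x j * H" using Suc by (simp only: mult.commute)
      then have "1 / real M / H ^ Suc n / H \<le> ?x j" using H by (subst pos_divide_le_eq) linarith+
      then show ?case by (simp add: mult.commute mult.left_commute del: v.simps)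
    qed
    from this[of R] have "1 / real M / H ^ Suc R \<le> v \<pi> R j" .
    also have "\<dots> \<le> (\<Sum>j=1..M. v \<pi> R j)"
      using j v_pos[OF \<pi>, of _ R] by (intro member_le_sum) (auto intro: less_imp_le)
    finally show "1 / real M / H ^ Suc R \<le> (\<Sum>j=1..M. v \<pi> R j)" .
  qed
qed

section \<open>Continuity and surjectivity onto the open simplex\<close>

lemma continuous_on_v:
  fixes f :: "'a::topological_space \<Rightarrow> nat \<Rightarrow> real"
  assumes f: "\<And>a. continuous_on S (\<lambda>x. f x a)" and S: "\<And>x. x \<in> S \<Longrightarrow> f x \<in> prob_simplex M"
  shows "continuous_on S (\<lambda>x. v (f x) n j)"
proof -
  have cY: "continuous_on S (\<lambda>x. Y (f x) c)" for c
  proof (cases "c \<in> {2..M - 1}")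
    case True
    then have "c \<in> {1..M}" by auto
    then have "f x c \<noteq> 0" if "x \<in> S" for x using simplex_pos[OF S[OF that], of c] by auto
    then show ?thesis
      unfolding Y_def FL_def FR_def by (auto intro!: continuous_intros continuous_on_left_moment f)
  qed (simp add: Y_outside)
  have "1 + kt c * Y (f x) c \<noteq> 0" if "x \<in> S" for x c
  proof (cases "c \<in> {2..M - 1}")
    case True
    then have "0 \<le> kt c * Y (f x) c" using kt[of c] Y_nonneg[OF S[OF that], of c] by auto
    then show ?thesis by linarith
  qed (simp add: Y_outside)
  then have "continuous_on S (\<lambda>x. v (f x) 0 c)" for c
    by (auto intro!: continuous_intros f cY)
  then show ?thesis
    by (induction n arbitrary: j)
       (auto intro!: continuous_on_tridiag_solve continuous_intros cY tridiag_conditions(1,2,5) S simp: Y_outside)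
qed

text \<open>The map of the simplex is lifted to the box \<open>S\<close> by normalising first. A
  fixed point \<open>x\<close> turns out to have total one, hence \<open>N x = x\<close>.\<close>

lemma simplex_point_with_image:
  assumes p: "p \<in> prob_simplex M"
  obtains \<pi> where "\<pi> \<in> prob_simplex M"
    and "\<And>j. j \<in> {1..M} \<Longrightarrow> v \<pi> R j / (\<Sum>a=1..M. v \<pi> R a) = p j"
proof -
  define \<Phi> where "\<Phi> \<pi> j = v \<pi> R j / (\<Sum>a=1..M. v \<pi> R a)" for \<pi> j
  obtain c where c: "0 < c" "\<And>\<pi>. \<pi> \<in> prob_simplex M \<Longrightarrow> c \<le> (\<Sum>j=1..M. v \<pi> R j)"
    using v_total_lower_bound[of R] by blast
  have ne: "{1..M} \<noteq> {}" using M by auto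
  define m where "m = Min (p ` {1..M})"
  have m: "0 < m" "m < 1" "\<And>j. j \<in> {1..M} \<Longrightarrow> m \<le> p j"
  proof -
    have "m \<in> p ` {1..M}" unfolding m_def using ne by (intro Min_in) auto
    then show "0 < m" "m < 1" using p by (auto simp: prob_simplex_def)
    show "m \<le> p j" if "j \<in> {1..M}" for j unfolding m_def using that by (intro Min_le) auto
  qed
  \<comment> \<open>Divided by the total mass, which is at least \<open>c\<close>, this bound makes
    a normalised coordinate at most half of the smallest target coordinate.\<close>
  have "0 < m / 2 * c" using m c by simp
  then obtain \<delta> where \<delta>: "0 < \<delta>"
    "\<And>\<pi> j. \<pi> \<in> prob_simplex M \<Longrightarrow> j \<in> {1..M} \<Longrightarrow> \<pi> j \<le> \<delta> \<Longrightarrow> v \<pi> R j \<le> m / 2 * c"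
    using v_coordinate_small[of "m / 2 * c" R] by blast
  have \<Phi>0: "0 \<le> \<Phi> \<pi> j" if "\<pi> \<in> prob_simplex M" "j \<in> {1..M}" for \<pi> j
    unfolding \<Phi>_def using that v_pos[OF that] c(2)[OF that(1)] c(1)
    by (intro divide_nonneg_nonneg) (auto intro: less_imp_le)
  have \<Phi>1: "(\<Sum>j=1..M. \<Phi> \<pi> j) = 1" if "\<pi> \<in> prob_simplex M" for \<pi>
    unfolding \<Phi>_def sum_divide_distrib[symmetric] using c(2)[OF that] c(1) by simp
  have \<Phi>_small: "\<Phi> \<pi> j \<le> m / 2" if "\<pi> \<in> prob_simplex M" "j \<in> {1..M}" "\<pi> j \<le> \<delta>" for \<pi> j
  proof -
    have "v \<pi> R j \<le> m / 2 * c" by (rule \<delta>(2)[OF that])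
    also have "\<dots> \<le> m / 2 * (\<Sum>j=1..M. v \<pi> R j)" using c(2)[OF that(1)] m by (intro mult_left_mono) auto
    finally show ?thesis
      unfolding \<Phi>_def using c(2)[OF that(1)] c(1) by (subst pos_divide_le_eq) linarith+
  qed
  \<comment> \<open>As \<open>1 + G x\<close> is at most 2, the lower faces are respected if
    \<open>2 * \<epsilon> \<le> N x j + g x j\<close>: either \<open>g x j\<close> is at least m /
    2, or \<open>N x j\<close> exceeds \<delta>.\<close>
  define \<epsilon> where "\<epsilon> = min (m / 4) (\<delta> / 2)"
  have \<epsilon>: "0 < \<epsilon>" "\<epsilon> < 1" "\<epsilon> \<le> m / 4" "\<epsilon> \<le> \<delta> / 2" using m \<delta> by (auto simp: \<epsilon>_def)
  define S where "S = {x :: nat \<Rightarrow> real. \<forall>j. x j \<in> {\<epsilon>..1}}"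
  define N where "N x j = x j / (\<Sum>a=1..M. x a)" for x :: "nat \<Rightarrow> real" and j
  have xpos: "0 < x j" if "x \<in> S" for x j
  proof -
    have "\<epsilon> \<le> x j" using that by (auto simp: S_def)
    with \<epsilon> show ?thesis by linarith
  qed
  have \<sigma>: "0 < (\<Sum>a=1..M. x a)" if "x \<in> S" for x
    using xpos[OF that] M by (intro sum_pos) auto
  have N: "N x \<in> prob_simplex M" if x: "x \<in> S" for x
  proof -
    have "x j < (\<Sum>a=1..M. x a)" if "j \<in> {1..M}" for j
    proof -
      have "(\<Sum>a=1..M. x a) = x j + (\<Sum>a\<in>{1..M} - {j}. x a)"
        using that by (simp add: sum.remove)
      moreover have "{1..M} - {j} \<noteq> {}"
      proof -
        have "(if j = 1 then 2 else 1) \<in> {1..M} - {j}" using M by auto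
        then show ?thesis by blast
      qed
      then have "0 < (\<Sum>a\<in>{1..M} - {j}. x a)" using xpos[OF x] by (intro sum_pos) auto
      ultimately show ?thesis by simp
    qed
    moreover have "(\<Sum>j=1..M. N x j) = 1"
      unfolding N_def sum_divide_distrib[symmetric] using \<sigma>[OF x] by simp
    ultimately show ?thesis
      using xpos[OF x] \<sigma>[OF x] by (auto simp: prob_simplex_def N_def)
  qed
  define g where "g x j = max 0 (p j - \<Phi> (N x) j)" for x j
  define G where "G x = (\<Sum>j=1..M. g x j)" for x
  define f where "f x j = (if j \<in> {1..M} then (N x j + g x j) / (1 + G x) else x j)" for x j
  have g0: "0 \<le> g x j" for x j by (simp add: g_def)
  have G0: "0 \<le> G x" for x unfolding G_def by (intro sum_nonneg g0)
  have coord: "continuous_on S (\<lambda>x. x j)" for j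
    by (rule continuous_on_subset[OF continuous_on_product_coordinates]) auto
  have cN: "continuous_on S (\<lambda>x. N x j)" for j
    unfolding N_def using \<sigma> by (auto intro!: continuous_intros coord) fastforce
  have cV: "continuous_on S (\<lambda>x. v (N x) R j)" for j
    by (rule continuous_on_v[OF cN N])
  have V0: "(\<Sum>a=1..M. v (N x) R a) \<noteq> 0" if "x \<in> S" for x
    using c(2)[OF N[OF that]] c(1) by linarith
  have cg: "continuous_on S (\<lambda>x. g x j)" for j
    unfolding g_def \<Phi>_def using V0 by (intro continuous_intros cV) auto
  have cG: "continuous_on S G"
    unfolding G_def by (intro continuous_intros cg)
  have cont: "continuous_on S (\<lambda>x. f x j)" for j
  proof (cases "j \<in> {1..M}")
    case True
    have "1 + G x \<noteq> 0" for x using G0[of x] by linarith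
    then have "continuous_on S (\<lambda>x. (N x j + g x j) / (1 + G x))"
      by (intro continuous_intros cN cg cG) auto
    then show ?thesis using True by (simp add: f_def)
  next
    case False
    then show ?thesis unfolding f_def if_not_P[OF False] by (intro coord)
  qed
  have maps: "f x j \<in> {\<epsilon>..1}" if x: "x \<in> S" for x j
  proof (cases "j \<in> {1..M}")
    case j: True
    have N0: "0 < N x j" "N x j < 1" using N[OF x] j by (auto simp: prob_simplex_def)
    have "g x a \<le> p a" if "a \<in> {1..M}" for a
      using \<Phi>0[OF N[OF x] that] p that by (auto simp: g_def prob_simplex_def less_imp_le)
    then have "G x \<le> (\<Sum>a=1..M. p a)" unfolding G_def by (rule sum_mono)
    then have G1: "G x \<le> 1" using p by (simp add: prob_simplex_def)
    have "g x j \<le> G x" unfolding G_def using j g0 by (intro member_le_sum) auto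
    then have "N x j + g x j \<le> 1 * (1 + G x)" using N0 by simp
    then have up: "f x j \<le> 1" using j G0[of x] by (simp add: f_def)
    have "2 * \<epsilon> \<le> N x j + g x j"
    proof (cases "N x j \<le> \<delta>")
      case True
      have "m / 2 \<le> g x j" using \<Phi>_small[OF N[OF x] j True] m(3)[OF j] unfolding g_def by linarith
      then show ?thesis using \<epsilon> N0 by linarith
    next
      case False
      then show ?thesis using \<epsilon> g0[of x j] by linarith
    qed
    moreover have "\<epsilon> * (1 + G x) \<le> \<epsilon> * 2" using G1 \<epsilon> by (intro mult_left_mono) auto
    ultimately have "\<epsilon> * (1 + G x) \<le> N x j + g x j" by linarith
    then have "\<epsilon> \<le> f x j" using j G0[of x] by (simp add: f_def pos_le_divide_eq)
    with up show ?thesis by simp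
  next
    case False
    then show ?thesis using x by (auto simp: f_def S_def)
  qed
  \<comment> \<open>\<open>brouwer_box_fun\<close> counts coordinates from 0, so
    \<open>M + 1\<close> of them are passed; \<open>f\<close> leaves coordinate 0 alone.\<close>
  obtain x where x: "\<forall>j. x j \<in> {\<epsilon>..1}" and fp: "\<And>j. j < M + 1 \<Longrightarrow> f x j = x j"
    using brouwer_box_fun[of \<epsilon> 1 "M + 1" f] \<epsilon> cont maps unfolding S_def by blast
  have xS: "x \<in> S" using x by (simp add: S_def)
  have fx: "x j * (1 + G x) = N x j + g x j" if "j \<in> {1..M}" for j
    using fp[of j] that G0[of x] by (auto simp: f_def field_simps)
  have N1: "(\<Sum>j=1..M. N x j) = 1" using N[OF xS] by (simp add: prob_simplex_def)
  have "(\<Sum>j=1..M. x j) * (1 + G x) = (\<Sum>j=1..M. N x j + g x j)"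
    unfolding sum_distrib_right by (intro sum.cong fx) auto
  also have "\<dots> = 1 + G x" using N1 by (simp add: sum.distrib G_def)
  finally have "(\<Sum>j=1..M. x j) = 1" using G0[of x] by simp
  then have Nx: "N x j = x j" for j by (simp add: N_def)
  then have gG: "g x j = x j * G x" if "j \<in> {1..M}" for j
    using fx[OF that] by (simp add: algebra_simps)
  have p1: "(\<Sum>j=1..M. p j) = 1" using p by (simp add: prob_simplex_def)
  \<comment> \<open>Otherwise every \<open>g x j = x j * G x\<close> is positive, so \<Phi> lies
    below \<open>p\<close> in all coordinates although both have total one.\<close>
  have "G x = 0"
  proof (rule ccontr)
    assume "G x \<noteq> 0"
    then have "0 < G x" using G0[of x] by simp
    then have "0 < g x j" if "j \<in> {1..M}" for j using gG[OF that] xpos[OF xS, of j] by simp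
    then have "\<Phi> (N x) j < p j" if "j \<in> {1..M}" for j
      using that by (fastforce simp: g_def)
    then have "(\<Sum>j=1..M. \<Phi> (N x) j) < (\<Sum>j=1..M. p j)" using ne by (intro sum_strict_mono) auto
    then show False using \<Phi>1[OF N[OF xS]] p1 by simp
  qed
  then have ge: "p j \<le> \<Phi> (N x) j" if "j \<in> {1..M}" for j
    using gG[OF that] by (simp add: g_def)
  have "p j = \<Phi> (N x) j" if "j \<in> {1..M}" for j
    by (rule sum_mono_inv[of p "{1..M}" "\<Phi> (N x)"]) (use ge that p1 \<Phi>1[OF N[OF xS]] in auto)
  then show thesis using that[OF N[OF xS]] by (simp add: \<Phi>_def)
qed

end

section \<open>The fixed point equation\<close>

lemma strict_mono_on_atLeastAtMost_SucI:
  fixes f :: "nat \<Rightarrow> 'a::order"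
  assumes "\<And>j. a \<le> j \<Longrightarrow> j < b \<Longrightarrow> f j < f (Suc j)"
  shows "strict_mono_on {a..b} f"
proof (rule strict_mono_onI)
  fix m n assume m: "m \<in> {a..b}" and n: "n \<in> {a..b}" and "m < n"
  from \<open>m < n\<close> have "Suc m \<le> n" by simp
  then have "n \<le> b \<longrightarrow> f m < f n"
  proof (induction n rule: dec_induct)
    case base
    then show ?case using assms[of m] m by auto
  next
    case (step n)
    then show ?case using assms[of n] m by (auto intro: less_trans)
  qed
  with n show "f m < f n" by auto
qed

text \<open>The increments \<open>epsilon\<close> are positive: the bounds on \<open>b\<close> make
  all factors of \<open>Pi_prod\<close> positive, and
  \<open>e_minus M p \<theta> < e_plus M p \<theta>\<close> makes the normalising sum
  nonempty.\<close>

lemma strict_mono_on_kappa: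
  fixes i p b :: "nat \<Rightarrow> real"
  assumes M: "3 \<le> M" and i: "strict_mono_on {1..M} i" and p: "p \<in> prob_simplex M"
    and up: "\<And>j. j \<in> {2..M - 1} \<Longrightarrow> 0 < 1 + (i (j + 1) - i j) * b j"
    and down: "\<And>j. j \<in> {2..M - 1} \<Longrightarrow> 0 < 1 - (i j - i (j - 1)) * b j"
    and \<theta>: "\<theta> < 1" and e: "e_minus M p \<theta> < e_plus M p \<theta>"
  shows "strict_mono_on {1..M} (kappa M i b p \<theta> e)"
proof -
  have p1: "(\<Sum>a=1..M. p a) = 1" using p by (simp add: prob_simplex_def)
  have delta: "0 < delta i j" if "2 \<le> j" "j \<le> M" for j
  proof -
    have "j - 1 \<in> {1..M}" "j \<in> {1..M}" "j - 1 < j" using that by auto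
    from strict_mono_onD[OF i this] show ?thesis by (simp add: delta_def)
  qed
  have Pi: "0 < Pi_prod i b j" if "j \<le> M - 1" for j
    unfolding Pi_prod_def using up down that by (intro prod_pos divide_pos_pos) (auto simp: delta_def)
  \<comment> \<open>Both index sets are nonempty because \<theta> is below the total mass, so
    \<open>Inf\<close> and \<open>Sup\<close> are attained in \<open>1..M\<close>.\<close>
  have "M \<in> {j\<in>{1..M}. (\<Sum>a=1..j. p a) \<ge> \<theta>}" using M p1 \<theta> by auto
  then have em: "1 \<le> e_minus M p \<theta>"
    unfolding e_minus_def using Inf_nat_def1[of "{j\<in>{1..M}. (\<Sum>a=1..j. p a) \<ge> \<theta>}"] by auto
  have "1 \<in> {j\<in>{1..M}. (\<Sum>a=j..M. p a) \<ge> \<theta>}" using M p1 \<theta> by auto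
  then have ep: "e_plus M p \<theta> \<le> M"
    unfolding e_plus_def Sup_nat_def using Max_in[of "{j\<in>{1..M}. (\<Sum>a=j..M. p a) \<ge> \<theta>}"] by auto
  have "0 < (\<Sum>a=e_minus M p \<theta>..e_plus M p \<theta> - 1. delta i (a + 1) * Pi_prod i b a)"
    using em ep e by (intro sum_pos mult_pos_pos delta Pi) auto
  moreover have "0 < K_const M i p \<theta>" by (simp add: K_const_def)
  ultimately have "0 < epsilon M i b p \<theta> j" if "2 \<le> j" "j \<le> M" for j
    unfolding epsilon_def using delta[of j] Pi[of "j - 1"] that by (intro divide_pos_pos mult_pos_pos) auto
  then show ?thesis
    using kappa_increment[of "Suc _" M i b p \<theta> e]
    by (intro strict_mono_on_atLeastAtMost_SucI) (force simp: algebra_simps)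
qed

text \<open>Used to pass from \<pi> to the vector Q, for which agreement is shown on
  \<open>1..M\<close> only.\<close>

lemma G_system_cong:
  assumes M: "3 \<le> M" and eq: "\<And>j. j \<in> {1..M} \<Longrightarrow> \<pi> j = \<pi>' j"
  shows "G_system M \<kappa> kt s \<pi> g = G_system M \<kappa> kt s \<pi>' g"
proof -
  have 1: "kappa_mean M \<kappa> kt s \<pi> g = kappa_mean M \<kappa> kt s \<pi>' g"
    unfolding kappa_mean_def using eq by (intro arg_cong2[where f = "(/)"] sum.cong) auto
  have 2: "(\<Sum>a=1..j - 1. (\<kappa> j - \<kappa> a) * \<pi> a * (1 + s * g a * kt a)) =
      (\<Sum>a=1..j - 1. (\<kappa> j - \<kappa> a) * \<pi>' a * (1 + s * g a * kt a))"
    "(\<Sum>a=j + 1..M. (\<kappa> a - \<kappa> j) * \<pi> a * (1 + s * g a * kt a)) =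
      (\<Sum>a=j + 1..M. (\<kappa> a - \<kappa> j) * \<pi>' a * (1 + s * g a * kt a))"
    "\<pi> j = \<pi>' j" if "j \<in> {2..M - 1}" for j
    using eq that by (auto intro!: sum.cong)
  show ?thesis
    unfolding G_system_def 1 by (simp only: 2 cong: ball_cong)
qed

text \<open>Column \<open>c\<close> meets only the rows c - 1, c and c + 1. One formula covers all
  columns: where \<open>lam\<close> vanishes the interior row degenerates to an identity row, and
  the absent rows 0 and M + 1 contribute zero.\<close>

lemma row_times_N_mat:
  assumes lam: "\<And>j. j \<notin> {2..M - 1} \<Longrightarrow> lam j = 0" and c: "c \<in> {1..M}"
  shows "(\<Sum>a=1..M. x a * N_mat M i b k s lam a c) =
    (1 + s * lam c * (1 + ktilde M i k c)) * x c - s * lam (c - 1) * q_up i b (c - 1) * x (c - 1)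
      - s * lam (c + 1) * q_down i b (c + 1) * x (c + 1)"
proof -
  have "x a * N_mat M i b k s lam a c =
      (if a = c then x a * (1 + s * lam a * (1 + ktilde M i k a)) else 0)
      + (if a = c - 1 then - (s * lam a * q_up i b a * x a) else 0)
      + (if a = c + 1 then - (s * lam a * q_down i b a * x a) else 0)" if "a \<in> {1..M}" for a
  proof (cases "a \<in> {2..M - 1}")
    case True
    then show ?thesis using c by (auto simp: N_mat_def)
  next
    case False
    then have "N_mat M i b k s lam a c = (if c = a then 1 else 0)" by (auto simp: N_mat_def)
    then show ?thesis unfolding lam[OF False] by simp
  qed
  then have "(\<Sum>a=1..M. x a * N_mat M i b k s lam a c) =
      (\<Sum>a=1..M. if a = c then x a * (1 + s * lam a * (1 + ktilde M i k a)) else 0)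
      + (\<Sum>a=1..M. if a = c - 1 then - (s * lam a * q_up i b a * x a) else 0)
      + (\<Sum>a=1..M. if a = c + 1 then - (s * lam a * q_down i b a * x a) else 0)"
    by (simp add: sum.distrib)
  also have "(\<Sum>a=1..M. if a = c - 1 then - (s * lam a * q_up i b a * x a) else 0) =
      - (s * lam (c - 1) * q_up i b (c - 1) * x (c - 1))"
    using lam[of "c - 1"] c by (subst sum.delta) auto
  also have "(\<Sum>a=1..M. if a = c + 1 then - (s * lam a * q_down i b a * x a) else 0) =
      - (s * lam (c + 1) * q_down i b (c + 1) * x (c + 1))"
    using lam[of "c + 1"] c by (subst sum.delta) auto
  also have "(\<Sum>a=1..M. if a = c then x a * (1 + s * lam a * (1 + ktilde M i k a)) else 0) =
      x c * (1 + s * lam c * (1 + ktilde M i k c))"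
    using c by (subst sum.delta) auto
  finally show ?thesis by (simp add: mult.commute)
qed

theorem theorem9p1:
  fixes t \<theta> :: real and r M e :: nat and i p b k :: "nat \<Rightarrow> real"
  assumes "3 \<le> M" and "0 < t" and "1 \<le> r"
    and "strict_mono_on {1..M} i"
    and "p \<in> prob_simplex M"
    and "\<forall>j\<in>{2..M - 1}. - (1 / (i (j + 1) - i j)) < b j \<and> b j < 1 / (i j - i (j - 1))"
    and "\<forall>j\<in>{2..M - 1}. 0 \<le> k j"
    and "0 < \<theta>" and "\<theta> < 1 / 2" and "e_minus M p \<theta> < e_plus M p \<theta>"
    and "e \<in> {1..M}" and "(\<Sum>a=1..e. p a) \<ge> 1 / 2" and "(\<Sum>a=e..M. p a) \<ge> 1 / 2"
  shows "\<exists>lam :: nat \<Rightarrow> real.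
           lam 1 = 0 \<and> lam M = 0 \<and> (\<forall>j\<in>{2..M - 1}. 0 \<le> lam j) \<and>
           Q_defined M i b k (t / real r) r p lam \<and>
           Q_vec M i k (t / real r) (h_iter M i b k (t / real r) (r - 1) p lam) lam
             \<in> prob_simplex M \<and>
           (\<forall>j\<in>{2..M - 1}. lam j = A_map M i b k \<theta> e t r lam p j)"
proof -
  define s where "s = t / real r"
  have s: "0 < s" using assms by (simp add: s_def)
  let ?\<kappa> = "kappa M i b p \<theta> e" and ?kt = "ktilde M i k"
  have gaps: "0 < i (j + 1) - i j" "0 < i j - i (j - 1)" "0 < i (j + 1) - i (j - 1)"
    if "j \<in> {2..M - 1}" for j
    using strict_mono_onD[OF \<open>strict_mono_on {1..M} i\<close>, of j "j + 1"]
      strict_mono_onD[OF \<open>strict_mono_on {1..M} i\<close>, of "j - 1" j]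
      strict_mono_onD[OF \<open>strict_mono_on {1..M} i\<close>, of "j - 1" "j + 1"] that by auto
  have up: "0 < 1 + (i (j + 1) - i j) * b j" if "j \<in> {2..M - 1}" for j
    using assms(6) gaps[OF that] that by (fastforce simp: field_simps)
  have down: "0 < 1 - (i j - i (j - 1)) * b j" if "j \<in> {2..M - 1}" for j
    using assms(6) gaps[OF that] that by (fastforce simp: field_simps)
  interpret W: killed_walk M ?\<kappa> ?kt "q_up i b" "q_down i b"
  proof
    show "3 \<le> M" by fact
    show "strict_mono_on {1..M} ?\<kappa>"
      by (rule strict_mono_on_kappa) (use assms up down in auto)
    show "0 \<le> ?kt j" if "j \<in> {1..M}" for j
      using gaps[of j] assms(7) by (auto simp: ktilde_def)
    show "0 < q_up i b j" if "j \<in> {2..M - 1}" for j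
      unfolding q_up_def using up[OF that] gaps[OF that] by (intro mult_pos_pos divide_pos_pos) auto
    show "0 < q_down i b j" if "j \<in> {2..M - 1}" for j
      unfolding q_down_def using down[OF that] gaps[OF that] by (intro mult_pos_pos divide_pos_pos) auto
    show "q_up i b j + q_down i b j = 1" if "j \<in> {2..M - 1}" for j
    proof -
      let ?D = "i (j + 1) - i (j - 1)"
      have "q_up i b j + q_down i b j = ((i j - i (j - 1)) * (1 + (i (j + 1) - i j) * b j)
          + (i (j + 1) - i j) * (1 - (i j - i (j - 1)) * b j)) / ?D"
        by (simp add: q_up_def q_down_def add_divide_distrib)
      also have "\<dots> = ?D / ?D" by (rule arg_cong[where f = "\<lambda>x. x / ?D"]) (simp add: algebra_simps)
      finally show ?thesis using gaps(3)[OF that] by simp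
    qed
  qed
  define R where "R = r - 1"
  obtain \<pi> where \<pi>: "\<pi> \<in> prob_simplex M"
    and image: "\<And>j. j \<in> {1..M} \<Longrightarrow> W.v \<pi> R j / (\<Sum>a=1..M. W.v \<pi> R a) = p j"
    using W.simplex_point_with_image[OF assms(5), of R] by blast
  \<comment> \<open>\<lambda> = G(s, \<pi>); the equation closes once \<pi> is recognised as the
    vector Q computed from \<open>p\<close> and this \<open>lam\<close>.\<close>
  define lam where "lam j = W.Y \<pi> j / s" for j
  have slam: "s * lam j = W.Y \<pi> j" for j using s by (simp add: lam_def)
  have lam0: "0 \<le> lam j" for j using W.Y_nonneg[OF \<pi>] s by (simp add: lam_def)
  have outside: "lam j = 0" if "j \<notin> {2..M - 1}" for j using W.Y_outside[OF that] by (simp add: lam_def)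
  let ?v = "W.v \<pi>"
  define V where "V n = (\<Sum>a=1..M. ?v n a)" for n
  have V: "0 < V n" for n
    unfolding V_def using W.v_pos[OF \<pi>] \<open>3 \<le> M\<close> by (intro sum_pos) auto
  have norm_v: "norm_const M i k s (\<lambda>j. ?v n j / V n) lam = (\<Sum>j=1..M. ?v n j * (1 + W.Y \<pi> j * ?kt j)) / V n" for n
    by (simp add: norm_const_def slam sum_divide_distrib)
  have balance: "(\<Sum>j=1..M. ?v (Suc n) j * (1 + W.Y \<pi> j * ?kt j)) = V n" for n
    unfolding V_def by (rule W.total_balance[symmetric]) (use W.v_eq[OF \<pi>] W.Y_outside in auto)
  \<comment> \<open>Multiplication by N lowers the index of \<open>v\<close> by one, so h leads from
    \<open>p\<close>, the normalised \<open>v\<close> with index \<open>R\<close>, back towards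
    index 0. By \<open>balance\<close> the norming constant is \<open>V m / V (Suc m)\<close>,
    exactly what keeps the vector normalised.\<close>
  have iter: "h_iter M i b k s n p lam c = ?v (R - n) c / V (R - n)"
    if "n \<le> R" "c \<in> {1..M}" for n c
    using that
  proof (induction n arbitrary: c)
    case 0
    then show ?case using image[of c] by (simp add: h_iter_def V_def)
  next
    case (Suc n)
    let ?x = "h_iter M i b k s n p lam"
    obtain m where m: "R - n = Suc m" "R - Suc n = m" using Suc.prems by (metis Suc_diff_Suc Suc_le_eq)
    have x: "?x a = ?v (Suc m) a / V (Suc m)" if "a \<in> {1..M}" for a
      using Suc.IH[of a] Suc.prems that m by simp
    have "norm_const M i k s ?x lam = norm_const M i k s (\<lambda>j. ?v (Suc m) j / V (Suc m)) lam"
      unfolding norm_const_def by (intro sum.cong) (use x in auto)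
    also have "\<dots> = V m / V (Suc m)" unfolding norm_v balance ..
    finally have 1: "norm_const M i k s ?x lam = V m / V (Suc m)" .
    have "(\<Sum>a=1..M. ?x a * N_mat M i b k s lam a c) =
        (\<Sum>a=1..M. ?v (Suc m) a * N_mat M i b k s lam a c) / V (Suc m)"
      unfolding sum_divide_distrib by (intro sum.cong) (use x in auto)
    also have "(\<Sum>a=1..M. ?v (Suc m) a * N_mat M i b k s lam a c) = ?v m c"
      using W.v_eq[OF \<pi> Suc.prems(2), of m]
      by (subst row_times_N_mat) (use Suc.prems in \<open>auto simp: slam outside simp del: W.v.simps\<close>)
    finally have 2: "(\<Sum>a=1..M. ?x a * N_mat M i b k s lam a c) = ?v m c / V (Suc m)" .
    have "h_iter M i b k s (Suc n) p lam c = h_map M i b k s ?x lam c"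
      by (simp add: h_iter_def)
    also have "\<dots> = ?v m c / V m"
      unfolding h_map_def 1 2 using V[of m] V[of "Suc m"] by (simp add: field_simps)
    finally show ?case using m by simp
  qed
  have norm_pos: "0 < norm_const M i k s (h_iter M i b k s n p lam) lam" if "n \<le> R" for n
    unfolding norm_const_def
  proof (rule sum_pos)
    fix j assume j: "j \<in> {1..M}"
    have "0 < ?v (R - n) j / V (R - n)" using V W.v_pos[OF \<pi> j] by simp
    moreover have "0 \<le> s * lam j * ?kt j" using s lam0[of j] W.kt[OF j] by simp
    ultimately show "0 < h_iter M i b k s n p lam j * (1 + s * lam j * ?kt j)"
      unfolding iter[OF that j] by (intro mult_pos_pos) auto
  qed (use \<open>3 \<le> M\<close> in auto)
  let ?h = "h_iter M i b k s R p lam"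
  \<comment> \<open>Stage 0 of \<open>v\<close> divides \<pi> by these factors; the definition of Q
    multiplies them back, so that Q equals \<pi>.\<close>
  have v0: "?v 0 j * (1 + W.Y \<pi> j * ?kt j) = \<pi> j" if "j \<in> {1..M}" for j
  proof -
    have "0 < 1 + ?kt j * W.Y \<pi> j"
      using W.kt[OF that] W.Y_nonneg[OF \<pi>, of j] by (intro add_pos_nonneg) auto
    then show ?thesis by (simp add: mult.commute)
  qed
  have "norm_const M i k s ?h lam = norm_const M i k s (\<lambda>j. ?v 0 j / V 0) lam"
    unfolding norm_const_def by (intro sum.cong) (use iter[of R] in auto)
  also have "\<dots> = (\<Sum>j=1..M. \<pi> j) / V 0"
    unfolding norm_v using v0 by (metis (no_types, lifting) sum.cong)
  finally have normR: "norm_const M i k s ?h lam = 1 / V 0"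
    using \<pi> by (simp add: prob_simplex_def)
  let ?Q = "Q_vec M i k s ?h lam"
  have Q: "?Q j = \<pi> j" if "j \<in> {1..M}" for j
  proof -
    have e1: "s * ?kt j * lam j = W.Y \<pi> j * ?kt j"
      by (simp add: slam[symmetric] mult.commute mult.left_commute)
    have e2: "?h j = ?v 0 j / V 0" using iter[OF order_refl that] by (simp del: W.v.simps)
    have "?Q j = ?v 0 j / V 0 * (1 + W.Y \<pi> j * ?kt j) / (1 / V 0)"
      unfolding Q_vec_def normR e1 e2 ..
    also have "\<dots> = ?v 0 j * (1 + W.Y \<pi> j * ?kt j)" using V[of 0] by simp
    finally show ?thesis using v0[OF that] by simp
  qed
  have QS: "?Q \<in> prob_simplex M"
    using \<pi> Q by (auto simp: prob_simplex_def)
  have "G_system M ?\<kappa> ?kt s \<pi> lam"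
    using W.G_system_Y[OF \<pi> s] by (simp add: lam_def[abs_def])
  then have "G_system M ?\<kappa> ?kt s ?Q lam"
    using G_system_cong[OF \<open>3 \<le> M\<close>, of ?Q \<pi>] Q by blast
  \<comment> \<open>The description defining \<open>G_vec\<close> also prescribes zero outside
    \<open>1..M\<close>.\<close>
  moreover have "lam j = 0" if "j \<notin> {1..M}" for j
    by (rule outside) (use that in auto)
  ultimately have "G_vec M ?\<kappa> ?kt s ?Q = lam"
    unfolding G_vec_def using G_system_unique[OF \<open>3 \<le> M\<close> W.\<kappa> _ s QS, of ?kt] W.kt
    by (intro the1_equality) blast+
  then have "lam j = A_map M i b k \<theta> e t r lam p j" for j
    by (simp add: A_map_def s_def R_def)
  moreover have "Q_defined M i b k s r p lam"
    unfolding Q_defined_def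
  proof (intro allI impI)
    fix n assume "n < r"
    then have "n \<le> R" by (simp add: R_def)
    then show "norm_const M i k s (h_iter M i b k s n p lam) lam \<noteq> 0" using norm_pos by fastforce
  qed
  moreover have "lam 1 = 0" "lam M = 0" using outside \<open>3 \<le> M\<close> by auto
  ultimately show ?thesis
    using lam0 QS unfolding s_def R_def by (intro exI[of _ lam]) auto
qed

end
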